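(* Let $p$ be a prime number and let $(K,|\cdot|)$ be an algebraically closed ultrametric field of residue characteristic $p$. Let $\lambda\in K$ satisfy $|\lambda|=1$, suppose the order $q$ of the reduction $\widetilde{\lambda}$ in $\widetilde{K}^*$ is finite, and suppose $\lambda^q\neq 1$. If $K$ has characteristic zero, assume in addition that $\lambda$ is transcendental over the prime field of $K$. Then there is a polynomial $P(z)=\lambda z+\cdots$ in $\mathcal{O}_K[z]$ of degree at most $2q+1$ such that for every integer $n\ge 1$, $P$ has an optimal cycle of period $qp^n$.
   Context: $\mathcal{O}_K=\{z\in K:|z|\le 1\}$, $\mathfrak{m}_K=\{z\in K:|z|<1\}$, $\widetilde{K}=\mathcal{O}_K/\mathfrak{m}_K$ is the residue field, and $\widetilde{a}$ denotes the reduction of $a\in\mathcal{O}_K$. A point $z_0\in\mathfrak{m}_K$ is periodic for $f$ of minimal period $\ell$ if $f^\ell(z_0)=z_0$ and $f^j(z_0)\ne z_0$ for $1\le j<\ell$. For a power series $f(z)=\lambda z+\cdots\in\mathcal{O}_K[[z]]$ with $|\lambda|=1$ and $\widetilde\lambda$ of finite order $q$ in $\widetilde K^*$, and an integer $n\ge1$ with $\lambda^{qp^n}\ne1$, $f$ is said to have an optimal cycle of period $qp^n$ if $f$ has a periodic point $z_0$ of minimal period $qp^n$ with $|z_0|=\left|\frac{\lambda^{qp^n}-1}{\lambda^{qp^{n-1}}-1}\right|^{1/(qp^n)}$. *)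

theory Defs
  imports "HOL-Computational_Algebra.Polynomial"
begin

definition ultrametric_abs :: "('a::field \<Rightarrow> real) \<Rightarrow> bool" where
  "ultrametric_abs av \<longleftrightarrow>
     (\<forall>x. 0 \<le> av x) \<and> (\<forall>x. av x = 0 \<longleftrightarrow> x = 0) \<and>
     (\<forall>x y. av (x * y) = av x * av y) \<and>
     (\<forall>x y. av (x + y) \<le> max (av x) (av y))"

definition alg_closed_field :: "'a::field itself \<Rightarrow> bool" where
  "alg_closed_field _ \<longleftrightarrow> (\<forall>P::'a poly. 0 < degree P \<longrightarrow> (\<exists>x. poly P x = 0))"

text \<open>Residue field has characteristic p (p prime): p maps into the maximal ideal.\<close>
definition residue_char :: "('a::field \<Rightarrow> real) \<Rightarrow> nat \<Rightarrow> bool" where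
  "residue_char av p \<longleftrightarrow> av (of_nat p) < 1"

text \<open>Order of the reduction of a unit \<open>lam\<close> in the residue field (0 if infinite).\<close>
definition red_order :: "('a::field \<Rightarrow> real) \<Rightarrow> 'a \<Rightarrow> nat" where
  "red_order av lam = (if \<exists>q>0. av (lam ^ q - 1) < 1
                       then (LEAST q. 0 < q \<and> av (lam ^ q - 1) < 1) else 0)"

text \<open>Transcendental over the prime field \<open>\<rat>\<close> (characteristic zero case):
  no nonzero integer polynomial vanishes at \<open>x\<close>.\<close>
definition transcendental_prime :: "'a::field \<Rightarrow> bool" where
  "transcendental_prime x \<longleftrightarrow> (\<forall>Q::int poly. Q \<noteq> 0 \<longrightarrow> poly (map_poly of_int Q) x \<noteq> 0)"

definition min_periodic :: "('a \<Rightarrow> 'a) \<Rightarrow> 'a \<Rightarrow> nat \<Rightarrow> bool" where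
  "min_periodic f z l \<longleftrightarrow> 0 < l \<and> (f ^^ l) z = z \<and> (\<forall>j. 1 \<le> j \<and> j < l \<longrightarrow> (f ^^ j) z \<noteq> z)"

text \<open>Optimal cycle of period \<open>q p^n\<close> for \<open>f(z) = lam z + \<dots>\<close>.\<close>
definition optimal_cycle ::
  "('a::field \<Rightarrow> real) \<Rightarrow> ('a \<Rightarrow> 'a) \<Rightarrow> 'a \<Rightarrow> nat \<Rightarrow> nat \<Rightarrow> nat \<Rightarrow> bool" where
  "optimal_cycle av f lam q p n \<longleftrightarrow>
     lam ^ (q * p ^ n) \<noteq> 1 \<and>
     (\<exists>z0. av z0 < 1 \<and> min_periodic f z0 (q * p ^ n) \<and>
        av z0 = root (q * p ^ n)
                  (av ((lam ^ (q * p ^ n) - 1) / (lam ^ (q * p ^ (n - 1)) - 1))))"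

end

theory Submission
  imports Defs "HOL-Computational_Algebra.Primes"
begin

text \<open>
  Take \<open>P(z) = \<lambda>z (1 + z\<^sup>q + b z\<^sup>2\<^sup>q)\<close> with an algebraic unit \<open>b\<close>. For a generic reduction of \<open>b\<close> the
  reduction of \<open>P\<close> is minimally ramified: \<open>P\<close> is semiconjugate via \<open>w = z\<^sup>q\<close> to a map
  \<open>g(w) = w + A w\<^sup>2 + B w\<^sup>3 + \<dots>\<close> modulo the maximal ideal, and \<open>g^(p^n) - w\<close> has order exactly
  \<open>2 + p + \<dots> + p^n\<close>. The latter follows by induction on \<open>n\<close>: the \<open>p\<close>-th difference
  of the identity along \<open>G = g^(p^n)\<close> is computed up to its second coefficient, which in turn is controlled by
  \<open>g \<circ> G = G \<circ> g\<close>. Hence the quotient of \<open>P^(q p^n) - z\<close> by \<open>P^(q p^(n-1)) - z\<close> has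
  exactly \<open>q p^n\<close> zeros in the open unit disc. If these form one cycle, its points have the same absolute
  value, which is read off the constant coefficient.

  Otherwise some cycle has a root of unity as multiplier. As \<open>\<lambda>\<close> is transcendental over the prime field, there
  is a valuation ring of \<open>K\<close> at which \<open>\<lambda>\<close> is infinite and \<open>b\<close>, \<open>1 - 4 b\<close>, \<open>q\<close> are units. There all
  periodic points of \<open>P\<close> are repelling, a contradiction.
\<close>

text \<open>Why a term in \<open>z^(2q)\<close>: for \<open>b = 0\<close> the quotient map is
  \<open>w (1 + w)^q\<close> up to its multiplier, so that \<open>A = q\<close>,
  \<open>B = q (q - 1) / 2\<close> and \<open>B - A^2 = - q (q + 1) / 2\<close>. This reduces to 0
  for odd \<open>p\<close> dividing \<open>q + 1\<close>, and for \<open>p = 2\<close> one of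
  \<open>B\<close> and \<open>B - A^2\<close> always reduces to 0. The induction on \<open>n\<close>
  needs units there. Why a second valuation: a zero of the quotient that is already fixed by
  \<open>P^(q p^(n-1))\<close>, with multiplier nu, satisfies
  \<open>1 + nu + ... + nu^(p-1) = 0\<close>. The absolute value cannot rule this out, since on the
  open disc these multipliers reduce to 1, as does every \<open>p\<close>-th root of unity. At the
  place, where \<open>lam\<close> is infinite, a multiplier is a positive power of
  \<open>lam\<close> times a unit. So \<open>b\<close> has to satisfy unit conditions for two
  unrelated valuations. It solves an equation over the prime ring that writes 1 as a product of
  quantities which must be units; the same equation then serves both.\<close>

section \<open>Ultrametric absolute values and the arithmetic of the unit disc\<close>

locale ultrametric_field =
  fixes av :: "'a::field \<Rightarrow> real"
  assumes ultrametric: "ultrametric_abs av"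
begin

lemma av_nonneg [simp]: "0 \<le> av x"
  and av_eq_0_iff [simp]: "av x = 0 \<longleftrightarrow> x = 0"
  and av_mult: "av (x * y) = av x * av y"
  and av_add_le: "av (x + y) \<le> max (av x) (av y)"
  using ultrametric by (auto simp: ultrametric_abs_def)

lemma av_0 [simp]: "av 0 = 0"
  by simp

lemma av_pos_iff [simp]: "0 < av x \<longleftrightarrow> x \<noteq> 0"
  using av_nonneg[of x] av_eq_0_iff[of x] by linarith

lemma av_1 [simp]: "av 1 = 1"
  using av_mult[of 1 1] by auto

lemma av_minus_1 [simp]: "av (- 1) = 1"
proof -
  have "av (- 1) ^ 2 = 1"
    using av_mult[of "- 1" "- 1"] by (simp add: power2_eq_square)
  then show ?thesis
    using av_nonneg[of "- 1"] by (smt (verit) power2_eq_1_iff)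
qed

lemma av_minus [simp]: "av (- x) = av x"
  using av_mult[of "- 1" x] by simp

lemma av_diff_le: "av (x - y) \<le> max (av x) (av y)"
  using av_add_le[of x "- y"] by simp

lemma av_minus_commute: "av (x - y) = av (y - x)"
  using av_minus[of "x - y"] by simp

lemma av_power: "av (x ^ n) = av x ^ n"
  by (induction n) (auto simp: av_mult)

lemma av_prod: "av (prod f A) = (\<Prod>i\<in>A. av (f i))"
  by (induction A rule: infinite_finite_induct) (auto simp: av_mult)

lemma av_add_le_1: "av x \<le> 1 \<Longrightarrow> av y \<le> 1 \<Longrightarrow> av (x + y) \<le> 1"
  using av_add_le[of x y] by simp

lemma av_diff_le_1: "av x \<le> 1 \<Longrightarrow> av y \<le> 1 \<Longrightarrow> av (x - y) \<le> 1"
  using av_diff_le[of x y] by simp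

lemma av_mult_le_1: "av x \<le> 1 \<Longrightarrow> av y \<le> 1 \<Longrightarrow> av (x * y) \<le> 1"
  by (simp add: av_mult mult_le_one)

lemma av_power_le_1: "av x \<le> 1 \<Longrightarrow> av (x ^ n) \<le> 1"
  by (simp add: av_power power_le_one)

lemma av_add_less_1: "av x < 1 \<Longrightarrow> av y < 1 \<Longrightarrow> av (x + y) < 1"
  using av_add_le[of x y] by simp

lemma av_diff_less_1: "av x < 1 \<Longrightarrow> av y < 1 \<Longrightarrow> av (x - y) < 1"
  using av_diff_le[of x y] by simp

lemma av_mult_less_1: "av x < 1 \<Longrightarrow> av y \<le> 1 \<Longrightarrow> av (x * y) < 1"
  using mult_left_le[of "av y" "av x"] by (simp add: av_mult)

lemma av_mult_less_1': "av x \<le> 1 \<Longrightarrow> av y < 1 \<Longrightarrow> av (x * y) < 1"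
  using av_mult_less_1[of y x] by (simp add: mult.commute)

lemma av_of_nat_le_1 [simp]: "av (of_nat n) \<le> 1"
  by (induction n) (auto intro: av_add_le_1)

lemma av_of_int_le_1 [simp]: "av (of_int n) \<le> 1"
  by (cases n) (auto intro: av_diff_le_1 simp flip: of_nat_Suc simp del: of_nat_Suc)

lemma av_numeral_le_1 [simp]: "av (numeral n) \<le> 1"
  using av_of_nat_le_1[of "numeral n"] by simp

lemma av_sum_le:
  assumes "\<And>i. i \<in> A \<Longrightarrow> av (f i) \<le> c" "0 \<le> c"
  shows "av (sum f A) \<le> c"
  using assms
proof (induction A rule: infinite_finite_induct)
  case (insert x F)
  then show ?case
    using av_add_le[of "f x" "sum f F"] by (simp add: max_def split: if_splits) (smt (verit))+
qed auto

lemma av_sum_less: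
  assumes "\<And>i. i \<in> A \<Longrightarrow> av (f i) < c" "0 < c"
  shows "av (sum f A) < c"
  using assms
proof (induction A rule: infinite_finite_induct)
  case (insert x F)
  then show ?case
    using av_add_le[of "f x" "sum f F"] by (simp add: max_def split: if_splits) (smt (verit))+
qed auto

lemma av_add_eq: "av x < av y \<Longrightarrow> av (x + y) = av y"
  using av_add_le[of x y] av_diff_le[of "x + y" x] by (simp add: max_def split: if_splits)

lemma av_eq_1_cong: "av (x - y) < 1 \<Longrightarrow> av x = 1 \<longleftrightarrow> av y = 1"
  using av_add_eq[of "x - y" y] av_add_eq[of "y - x" x] by (auto simp: av_minus_commute)

lemma av_less_1_cong: "av (x - y) < 1 \<Longrightarrow> av x < 1 \<longleftrightarrow> av y < 1"
  using av_add_less_1[of "x - y" y] av_add_less_1[of "y - x" x] by (auto simp: av_minus_commute)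

lemma av_mult_eq_1_iff:
  assumes "av x \<le> 1" "av y \<le> 1"
  shows "av (x * y) = 1 \<longleftrightarrow> av x = 1 \<and> av y = 1"
  using assms av_mult_less_1[of x y] av_mult_less_1'[of x y] by (auto simp: av_mult less_le)

lemma av_prod_dvd_1:
  assumes "av (x * y) = 1" "av x \<le> 1" "av y \<le> 1"
  shows "av x = 1" "av y = 1"
  using assms av_mult_eq_1_iff by auto

lemma av_of_nat_dvd:
  assumes "av (of_nat p) < 1" "p dvd n"
  shows "av (of_nat n) < 1"
  using assms by (auto elim!: dvdE simp: av_mult_less_1)

text \<open>Bezout: some integer combination of \<open>p\<close> and \<open>n\<close> is 1, and its
  \<open>p\<close>-part is small.\<close>

lemma av_of_nat_eq_1:
  assumes p: "av (of_nat p) < 1" and "prime p" "\<not> p dvd n"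
  shows "av (of_nat n) = 1"
proof -
  have "coprime p n"
    using assms by (simp add: prime_imp_coprime)
  then obtain a b where ab: "a * int p + b * int n = 1"
    by (metis bezout_int coprime_imp_gcd_eq_1 coprime_int_iff)
  then have eq: "of_int a * of_nat p + of_int b * of_nat n = (1 :: 'a)"
    by (metis of_int_1 of_int_add of_int_mult of_int_of_nat_eq)
  have "av (1 - of_int b * of_nat n) < 1"
    using av_mult_less_1'[OF av_of_int_le_1[of a] p] by (simp flip: eq)
  then have "av (of_int b * of_nat n) = 1"
    using av_eq_1_cong av_1 by blast
  then show ?thesis
    by (rule av_prod_dvd_1) auto
qed

section \<open>Polynomials vanishing to a given order modulo the maximal ideal\<close>

text \<open>\<open>vanishes k P\<close> says that \<open>P\<close> has coefficients in the valuation ring and that its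
  reduction is divisible by \<open>x ^ k\<close>; in \<open>exact_order k P\<close> the reduction has order exactly \<open>k\<close>.\<close>

definition vanishes :: "nat \<Rightarrow> 'a poly \<Rightarrow> bool" where
  "vanishes k P \<longleftrightarrow> (\<forall>i. av (coeff P i) \<le> 1) \<and> (\<forall>i<k. av (coeff P i) < 1)"

definition exact_order :: "nat \<Rightarrow> 'a poly \<Rightarrow> bool" where
  "exact_order k P \<longleftrightarrow> vanishes k P \<and> av (coeff P k) = 1"

abbreviation integral_poly :: "'a poly \<Rightarrow> bool" where
  "integral_poly \<equiv> vanishes 0"

lemma integral_poly_def: "integral_poly P \<longleftrightarrow> (\<forall>i. av (coeff P i) \<le> 1)"
  by (simp add: vanishes_def)

lemma vanishesD: "vanishes k P \<Longrightarrow> i < k \<Longrightarrow> av (coeff P i) < 1"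
  by (simp add: vanishes_def)

lemma vanishes_coeff_le_1: "vanishes k P \<Longrightarrow> av (coeff P i) \<le> 1"
  by (simp add: vanishes_def)

lemma vanishes_mono: "vanishes k P \<Longrightarrow> j \<le> k \<Longrightarrow> vanishes j P"
  by (simp add: vanishes_def)

lemma vanishes_imp_integral: "vanishes k P \<Longrightarrow> integral_poly P"
  by (rule vanishes_mono) auto

lemma vanishes_0 [simp]: "vanishes k 0"
  by (simp add: vanishes_def)

lemma vanishes_add: "vanishes k P \<Longrightarrow> vanishes k Q \<Longrightarrow> vanishes k (P + Q)"
  by (auto simp: vanishes_def intro: av_add_le_1 av_add_less_1)

lemma vanishes_minus: "vanishes k P \<Longrightarrow> vanishes k (- P)"
  by (auto simp: vanishes_def)

lemma vanishes_diff: "vanishes k P \<Longrightarrow> vanishes k Q \<Longrightarrow> vanishes k (P - Q)"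
  by (auto simp: vanishes_def intro: av_diff_le_1 av_diff_less_1)

lemma vanishes_sum: "(\<And>i. i \<in> A \<Longrightarrow> vanishes k (f i)) \<Longrightarrow> vanishes k (sum f A)"
  by (induction A rule: infinite_finite_induct) (auto intro: vanishes_add)

lemma vanishes_smult: "av c \<le> 1 \<Longrightarrow> vanishes k P \<Longrightarrow> vanishes k (smult c P)"
  by (auto simp: vanishes_def intro: av_mult_le_1 av_mult_less_1')

lemma vanishes_smult_small: "av c < 1 \<Longrightarrow> integral_poly P \<Longrightarrow> vanishes k (smult c P)"
  by (auto simp: vanishes_def intro: av_mult_le_1 av_mult_less_1)

lemma vanishes_monom: "av c \<le> 1 \<Longrightarrow> k \<le> n \<Longrightarrow> vanishes k (monom c n)"
  by (auto simp: vanishes_def)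

lemma vanishes_monom_small: "av c < 1 \<Longrightarrow> vanishes k (monom c n)"
  by (auto simp: vanishes_def)

lemma integral_const: "av c \<le> 1 \<Longrightarrow> integral_poly [:c:]"
  by (auto simp: vanishes_def coeff_pCons split: nat.splits)

lemma integral_1 [simp]: "integral_poly 1"
  using integral_const[of 1] by (simp add: one_pCons)

lemma vanishes_X [simp]: "vanishes (Suc 0) [:0, 1:]"
  by (auto simp: vanishes_def coeff_pCons split: nat.splits)

lemma integral_X [simp]: "integral_poly [:0, 1:]"
  using vanishes_X by (rule vanishes_imp_integral)

lemma vanishes_mult:
  assumes P: "vanishes a P" and Q: "vanishes b Q"
  shows "vanishes (a + b) (P * Q)"
proof -
  have "av (coeff (P * Q) n) \<le> 1" for n
    unfolding coeff_mult using P Q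
    by (intro av_sum_le av_mult_le_1) (auto intro: vanishes_coeff_le_1)
  moreover have "av (coeff (P * Q) n) < 1" if "n < a + b" for n
    unfolding coeff_mult
  proof (rule av_sum_less)
    fix i assume "i \<in> {..n}"
    with that have "i < a \<or> n - i < b"
      by auto
    then consider "i < a" | "n - i < b"
      by blast
    then show "av (coeff P i * coeff Q (n - i)) < 1"
      using P Q by cases (auto intro: av_mult_less_1 av_mult_less_1' vanishes_coeff_le_1 vanishesD)
  qed auto
  ultimately show ?thesis
    by (auto simp: vanishes_def)
qed

lemma integral_mult: "integral_poly P \<Longrightarrow> integral_poly Q \<Longrightarrow> integral_poly (P * Q)"
  using vanishes_mult[of 0 P 0 Q] by simp

lemma vanishes_power: "vanishes a P \<Longrightarrow> vanishes (a * n) (P ^ n)"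
proof (induction n)
  case (Suc n)
  then show ?case
    using vanishes_mult[of a P "a * n" "P ^ n"] by simp
qed auto

lemma integral_power: "integral_poly P \<Longrightarrow> integral_poly (P ^ n)"
  using vanishes_power[of 0 P n] by simp

text \<open>\<open>r\<close> is a relative precision: if each factor is known to \<open>r\<close>
  orders beyond its own order, so is the product. Inductions over powers use this form.\<close>

lemma vanishes_mult_diff:
  assumes "vanishes a P" "vanishes b Q'" "vanishes (a + r) (P - P')" "vanishes (b + r) (Q - Q')"
  shows "vanishes (a + b + r) (P * Q - P' * Q')"
proof -
  have "P * Q - P' * Q' = P * (Q - Q') + (P - P') * Q'"
    by (simp add: algebra_simps)
  moreover have "vanishes (a + b + r) (P * (Q - Q'))"
    using vanishes_mult[OF assms(1,4)] by (simp add: add_ac)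
  moreover have "vanishes (a + b + r) ((P - P') * Q')"
    using vanishes_mult[OF assms(3,2)] by (simp add: add_ac)
  ultimately show ?thesis
    by (simp add: vanishes_add)
qed

lemma integral_pcompose:
  assumes "integral_poly P" "integral_poly G"
  shows "integral_poly (P \<circ>\<^sub>p G)"
  using assms(1)
proof (induction P)
  case (pCons a P)
  have "integral_poly P"
    using pCons.prems by (auto simp: vanishes_def coeff_pCons split: nat.splits)
  moreover have "av a \<le> 1"
    using pCons.prems vanishes_coeff_le_1[of 0 "pCons a P" 0] by simp
  ultimately show ?case
    using assms(2) pCons.IH
    by (auto simp: pcompose_pCons intro!: vanishes_add integral_mult integral_const)
qed auto

lemma exact_order_mult:
  assumes "exact_order a P" "exact_order b Q"
  shows "exact_order (a + b) (P * Q)"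
proof -
  have P: "vanishes a P" "av (coeff P a) = 1" and Q: "vanishes b Q" "av (coeff Q b) = 1"
    using assms by (auto simp: exact_order_def)
  have "coeff (P * Q) (a + b) = coeff P a * coeff Q b
          + (\<Sum>i\<in>{..a + b} - {a}. coeff P i * coeff Q (a + b - i))"
    unfolding coeff_mult by (subst sum.remove[of _ a]) auto
  moreover have small: "av (\<Sum>i\<in>{..a + b} - {a}. coeff P i * coeff Q (a + b - i)) < 1"
  proof (rule av_sum_less)
    fix i assume "i \<in> {..a + b} - {a}"
    then consider "i < a" | "a + b - i < b"
      by fastforce
    then show "av (coeff P i * coeff Q (a + b - i)) < 1"
      using P Q by cases (auto intro: av_mult_less_1 av_mult_less_1' vanishes_coeff_le_1 vanishesD)
  qed auto
  moreover have "av (coeff P a * coeff Q b) = 1"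
    using P Q by (simp add: av_mult)
  ultimately have "av (coeff (P * Q) (a + b)) = 1"
    using av_add_eq[of "\<Sum>i\<in>{..a + b} - {a}. coeff P i * coeff Q (a + b - i)"
        "coeff P a * coeff Q b"] by (simp add: add.commute)
  then show ?thesis
    using P Q vanishes_mult by (auto simp: exact_order_def av_mult)
qed

lemma exact_order_unique:
  assumes "exact_order a P" "exact_order b P"
  shows "a = b"
  using assms unfolding exact_order_def vanishes_def by (metis less_irrefl linorder_neqE_nat)

text \<open>For \<open>P\<close> only integrality is known beforehand. Without a unit coefficient it
  would vanish to every order and push the product beyond order \<open>a + b\<close>; hence it has
  some exact order, and orders add.\<close>

lemma exact_order_cancel:
  assumes PQ: "exact_order (a + b) (P * Q)" and P: "integral_poly P" and Q: "exact_order b Q"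
  shows "exact_order a P"
proof -
  have "\<exists>k. exact_order k P"
  proof (rule ccontr)
    assume none: "\<nexists>k. exact_order k P"
    have "vanishes k P" for k
    proof (induction k)
      case (Suc k)
      then have "av (coeff P k) < 1"
        using none vanishes_coeff_le_1[OF P, of k] by (fastforce simp: exact_order_def)
      with Suc show ?case
        by (auto simp: vanishes_def less_Suc_eq)
    qed (use P in auto)
    from vanishes_mult[OF this[of "Suc a"], of b Q] Q have "vanishes (Suc a + b) (P * Q)"
      by (simp add: exact_order_def)
    then show False
      using PQ by (auto simp: exact_order_def vanishes_def)
  qed
  then obtain k where k: "exact_order k P" ..
  with exact_order_mult[OF k Q] PQ exact_order_unique have "k + b = a + b"
    by blast
  with k show ?thesis
    by simp
qed

lemma exact_order_cong:
  assumes "vanishes (Suc k) (P - Q)"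
  shows "exact_order k P \<longleftrightarrow> exact_order k Q"
proof -
  have main: "exact_order k Q" if "vanishes (Suc k) (P - Q)" "exact_order k P" for P Q
  proof -
    have "vanishes k Q"
      using vanishes_diff[of k P "P - Q"] vanishes_mono[OF that(1)] that(2)
      by (auto simp: exact_order_def)
    moreover have "av (coeff P k - coeff Q k) < 1"
      using vanishesD[OF that(1), of k] by simp
    ultimately show ?thesis
      using av_eq_1_cong[of "coeff P k" "coeff Q k"] that(2) by (auto simp: exact_order_def)
  qed
  show ?thesis
    using main[of P Q] main[of Q P] assms vanishes_minus[OF assms] by auto
qed

end

section \<open>Composition of polynomials\<close>

definition iter_poly :: "'a::comm_semiring_1 poly \<Rightarrow> nat \<Rightarrow> 'a poly" where
  "iter_poly f n = ((\<circ>\<^sub>p) f ^^ n) [:0, 1:]"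

lemma pcompose_X [simp]: "[:0, 1:] \<circ>\<^sub>p (G :: 'a::comm_semiring_1 poly) = G"
  by (simp add: pcompose_pCons)

lemma iter_poly_0 [simp]: "iter_poly f 0 = [:0, 1:]"
  and iter_poly_Suc: "iter_poly f (Suc n) = f \<circ>\<^sub>p iter_poly f n"
  by (simp_all add: iter_poly_def)

lemma iter_poly_1 [simp]: "iter_poly f (Suc 0) = f"
  by (simp add: iter_poly_Suc)

lemma poly_iter_poly: "poly (iter_poly f n) x = (poly f ^^ n) x"
  by (induction n) (simp_all add: iter_poly_Suc poly_pcompose)

lemma iter_poly_add: "iter_poly f (m + n) = iter_poly f m \<circ>\<^sub>p iter_poly f n"
  by (induction m) (simp_all add: iter_poly_Suc pcompose_assoc)

lemma iter_poly_Suc': "iter_poly f (Suc n) = iter_poly f n \<circ>\<^sub>p f"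
  using iter_poly_add[of f n 1] by simp

lemma iter_poly_mult: "iter_poly (iter_poly f m) n = iter_poly f (m * n)"
  by (induction n) (simp_all add: iter_poly_Suc iter_poly_add)

lemma pcompose_monom: "monom c n \<circ>\<^sub>p G = smult c (G ^ n)"
  for G :: "'a::comm_ring_1 poly"
  by (induction n) (simp_all add: monom_Suc pcompose_pCons monom_0)

lemma pcompose_expand: "P \<circ>\<^sub>p G = (\<Sum>i\<le>degree P. smult (coeff P i) (G ^ i))"
  for G :: "'a::comm_ring_1 poly"
proof -
  have "P \<circ>\<^sub>p G = (\<Sum>i\<le>degree P. monom (coeff P i) i) \<circ>\<^sub>p G"
    by (simp add: poly_as_sum_of_monoms)
  then show ?thesis
    by (simp add: pcompose_sum pcompose_monom)
qed

definition comp_diff :: "'a::comm_ring_1 poly \<Rightarrow> 'a poly \<Rightarrow> 'a poly" where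
  "comp_diff G P = P \<circ>\<^sub>p G - P"

lemma comp_diff_add: "comp_diff G (P + Q) = comp_diff G P + comp_diff G Q"
  by (simp add: comp_diff_def pcompose_add)

lemma comp_diff_monom: "comp_diff G (monom c n) = smult c (G ^ n - monom 1 n)"
  by (simp add: comp_diff_def pcompose_monom smult_diff_right smult_monom)

text \<open>Composition with \<open>G\<close> is \<open>1 + comp_diff G\<close>, so this is the binomial theorem.\<close>

lemma pcompose_iter_poly:
  "P \<circ>\<^sub>p iter_poly G n = (\<Sum>k\<le>n. smult (of_nat (n choose k)) ((comp_diff G ^^ k) P))"
proof (induction n)
  case (Suc n)
  define t where "t k = (comp_diff G ^^ k) P" for k
  have t: "t k \<circ>\<^sub>p G = t k + t (Suc k)" for k
    by (simp add: t_def comp_diff_def)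
  have "P \<circ>\<^sub>p iter_poly G (Suc n) = (\<Sum>k\<le>n. smult (of_nat (n choose k)) (t k)) \<circ>\<^sub>p G"
    using Suc by (simp add: iter_poly_Suc' pcompose_assoc t_def)
  also have "\<dots> = (\<Sum>k\<le>n. smult (of_nat (n choose k)) (t k))
      + (\<Sum>k\<le>n. smult (of_nat (n choose k)) (t (Suc k)))"
    by (simp add: pcompose_sum pcompose_smult t smult_add_right sum.distrib)
  also have "(\<Sum>k\<le>n. smult (of_nat (n choose k)) (t k))
      = (\<Sum>k\<le>Suc n. smult (of_nat (n choose k)) (t k))"
    by (simp add: binomial_eq_0)
  also have "\<dots> = t 0 + (\<Sum>k\<le>n. smult (of_nat (n choose Suc k)) (t (Suc k)))"
    by (subst sum.atMost_Suc_shift) simp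
  also have "\<dots> + (\<Sum>k\<le>n. smult (of_nat (n choose k)) (t (Suc k)))
      = t 0 + (\<Sum>k\<le>n. smult (of_nat (Suc n choose Suc k)) (t (Suc k)))"
    by (simp add: sum.distrib smult_add_left add_ac)
  also have "\<dots> = (\<Sum>k\<le>Suc n. smult (of_nat (Suc n choose k)) (t k))"
    by (subst sum.atMost_Suc_shift) simp
  finally show ?case
    by (simp add: t_def)
qed simp

section \<open>Differences along a polynomial tangent to the identity\<close>

context ultrametric_field
begin

lemma vanishes_power_diff:
  assumes "vanishes (e + 1) (G - [:0, 1:])"
  shows "vanishes (i + e) (G ^ i - [:0, 1:] ^ i)"
proof (induction i)
  case (Suc i)
  have "vanishes 1 G"
    using vanishes_add[of 1 "G - [:0, 1:]" "[:0, 1:]"] vanishes_mono[OF assms, of 1] by simp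
  then have "vanishes (1 + i + e) (G * G ^ i - [:0, 1:] * [:0, 1:] ^ i)"
    using assms Suc vanishes_power[OF vanishes_X, of i]
    by (intro vanishes_mult_diff) (auto simp: add_ac)
  then show ?case
    by simp
qed simp

text \<open>Coefficients of \<open>P\<close> below degree \<open>k\<close> are small anyway; the
  others multiply \<open>G^i - x^i\<close>, of order \<open>i + e\<close>. Each difference thus
  gains \<open>e\<close> orders, which is why the \<open>m\<close>-th difference of the identity
  starts in degree \<open>m e + 1\<close>.\<close>

lemma vanishes_comp_diff:
  assumes P: "vanishes k P" and G: "vanishes (e + 1) (G - [:0, 1:])"
  shows "vanishes (k + e) (comp_diff G P)"
proof -
  have "comp_diff G P = P \<circ>\<^sub>p G - P \<circ>\<^sub>p [:0, 1:]"
    by (simp add: comp_diff_def)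
  also have "\<dots> = (\<Sum>i\<le>degree P. smult (coeff P i) (G ^ i - [:0, 1:] ^ i))"
    unfolding pcompose_expand by (simp add: sum_subtractf smult_diff_right)
  also have "vanishes (k + e) \<dots>"
  proof (rule vanishes_sum)
    fix i
    have *: "vanishes (i + e) (G ^ i - [:0, 1:] ^ i)"
      by (rule vanishes_power_diff[OF G])
    show "vanishes (k + e) (smult (coeff P i) (G ^ i - [:0, 1:] ^ i))"
    proof (cases "i < k")
      case True
      then show ?thesis
        using P * by (intro vanishes_smult_small) (auto intro: vanishesD vanishes_imp_integral)
    next
      case False
      then show ?thesis
        using P vanishes_mono[OF *, of "k + e"] by (intro vanishes_smult vanishes_coeff_le_1) auto
    qed
  qed
  finally show ?thesis .
qed

lemma two_term_expansion:
  assumes "vanishes k P"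
  shows "vanishes (k + 2) (P - (monom (coeff P k) k + monom (coeff P (k + 1)) (k + 1)))"
  using assms unfolding vanishes_def
  by (auto simp: less_Suc_eq numeral_2_eq_2)

text \<open>If \<open>u\<close> has order \<open>e\<close>, the quadratic term of \<open>(1 + u) ^ k\<close> has order \<open>2 e\<close> and reaches the second
  coefficient only for \<open>e = 1\<close>.\<close>

definition quad_term :: "nat \<Rightarrow> 'a \<Rightarrow> nat \<Rightarrow> 'a" where
  "quad_term e C k = (if e = 1 then of_nat (k choose 2) * C\<^sup>2 else 0)"

lemma av_quad_term_le_1: "av C \<le> 1 \<Longrightarrow> av (quad_term e C k) \<le> 1"
  by (auto simp: quad_term_def intro!: av_mult_le_1 av_power_le_1)

lemma power_expansion:
  assumes G: "vanishes (e + 3) (G - ([:0, 1:] + monom C (e + 1) + monom D (e + 2)))"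
    and e: "1 \<le> e" and C: "av C \<le> 1" and D: "av D \<le> 1"
  shows "vanishes (k + e + 2) (G ^ k - (monom 1 k + monom (of_nat k * C) (k + e)
           + monom (of_nat k * D + quad_term e C k) (k + e + 1)))"
proof (induction k)
  case 0
  then show ?case
    by (simp add: quad_term_def monom_0 one_pCons binomial_eq_0)
next
  case (Suc k)
  define L where "L = [:0, 1:] + monom C (e + 1) + monom D (e + 2)"
  define c d where "c = of_nat k * C" and "d = of_nat k * D + quad_term e C k"
  define M where "M = monom 1 k + monom c (k + e) + monom d (k + e + 1)"
  have c: "av c \<le> 1" and d: "av d \<le> 1"
    unfolding c_def d_def using C D
    by (auto intro!: av_add_le_1 av_mult_le_1 av_quad_term_le_1)
  have L: "vanishes 1 L" and M: "vanishes k M"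
    unfolding L_def M_def using C D c d by (auto intro!: vanishes_add vanishes_monom)
  have "vanishes 1 G"
    using vanishes_add[OF vanishes_mono[OF G, of 1] L] by (simp add: L_def)
  then have *: "vanishes (1 + k + (e + 2)) (G * G ^ k - L * M)"
    using G Suc M by (intro vanishes_mult_diff) (simp_all add: L_def M_def c_def d_def add_ac numeral_3_eq_3)
  let ?T = "monom 1 (Suc k) + monom (of_nat (Suc k) * C) (Suc k + e)
      + monom (of_nat (Suc k) * D + quad_term e C (Suc k)) (Suc k + e + 1)"
  have "[:0, 1:] = monom (1::'a) 1"
    by (simp add: monom_altdef)
  then have LM: "L * M = monom 1 (Suc k) + monom (c + C) (Suc k + e)
     + monom (d + D) (Suc k + e + 1) + monom (C * c) (k + 2 * e + 1)
     + (monom (C * d + D * c) (k + 2 * e + 2) + monom (D * d) (k + 2 * e + 3))"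
    by (simp add: L_def M_def mult_monom algebra_simps add_monom[symmetric]
        numeral_3_eq_3 mult_2 mult_2_right)
  \<comment> \<open>The product \<open>C c\<close> sits in degree \<open>k + 2 e + 1\<close>. This
    is the last retained degree \<open>k + e + 2\<close> exactly for \<open>e = 1\<close>, where
    Pascal's rule absorbs it into \<open>quad_term\<close>; otherwise it is beyond the
    precision.\<close>
  have "vanishes (1 + k + (e + 2)) (L * M - ?T)"
  proof (cases "e = 1")
    case True
    have "quad_term e C (Suc k) = quad_term e C k + C * c"
      using True by (simp add: quad_term_def c_def algebra_simps power2_eq_square numeral_2_eq_2)
    then have "L * M - ?T = monom (C * d + D * c) (k + 2 * e + 2) + monom (D * d) (k + 2 * e + 3)"
      unfolding LM using True by (simp add: c_def d_def algebra_simps add_monom[symmetric] numeral_2_eq_2)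
    then show ?thesis
      using e C D c d by (auto intro!: vanishes_add vanishes_monom av_add_le_1 av_mult_le_1)
  next
    case False
    then have "L * M - ?T = monom (C * c) (k + 2 * e + 1) + (monom (C * d + D * c) (k + 2 * e + 2)
        + monom (D * d) (k + 2 * e + 3))"
      unfolding LM by (simp add: c_def d_def quad_term_def algebra_simps add_monom[symmetric])
    then show ?thesis
      using e False C D c d by (auto intro!: vanishes_add vanishes_monom av_add_le_1 av_mult_le_1)
  qed
  from vanishes_add[OF * this] have "vanishes (1 + k + (e + 2)) (G * G ^ k - ?T)"
    by (simp only: diff_add_eq_diff_diff_swap[symmetric] diff_add_cancel add_diff_eq)
  moreover have "1 + k + (e + 2) = Suc k + e + 2"
    by simp
  ultimately show ?case
    by (simp only: power_Suc)
qed

text \<open>The term in degree \<open>k\<close> contributes both of its corrections. The term in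
  degree \<open>k + 1\<close> contributes only its first, because its second has degree
  \<open>k + e + 2\<close>, and the remainder of order \<open>k + 2\<close> is lifted to that order
  as well.\<close>

lemma comp_diff_expansion:
  assumes G: "vanishes (e + 3) (G - ([:0, 1:] + monom C (e + 1) + monom D (e + 2)))"
    and e: "1 \<le> e" and C: "av C \<le> 1" and D: "av D \<le> 1"
    and P: "vanishes (k + 2) (P - (monom a k + monom b (k + 1)))"
    and a: "av a \<le> 1" and b: "av b \<le> 1"
  shows "vanishes (k + e + 2) (comp_diff G P - (monom (a * of_nat k * C) (k + e)
    + monom (a * (of_nat k * D + quad_term e C k) + b * of_nat (k + 1) * C) (k + e + 1)))"
proof -
  define R where "R = P - (monom a k + monom b (k + 1))"
  define U where "U k = G ^ k - (monom 1 k + monom (of_nat k * C) (k + e)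
           + monom (of_nat k * D + quad_term e C k) (k + e + 1))" for k
  have U: "vanishes (k + e + 2) (U k)" for k
    unfolding U_def by (rule power_expansion[OF G e C D])
  have "vanishes (e + 1) (G - ([:0, 1:] + monom C (e + 1) + monom D (e + 2))
          + (monom C (e + 1) + monom D (e + 2)))"
    using C D by (intro vanishes_add vanishes_mono[OF G] vanishes_monom) auto
  moreover have "G - (X + Y + Z) + (Y + Z) = G - X" for X Y Z
    by simp
  ultimately have GX: "vanishes (e + 1) (G - [:0, 1:])"
    by metis
  have R: "vanishes (k + e + 2) (comp_diff G R)"
    using vanishes_comp_diff[OF P GX] by (simp add: R_def add_ac)
  have "P = monom a k + monom b (k + 1) + R"
    by (simp add: R_def)
  then have "comp_diff G P = smult a (G ^ k - monom 1 k) + smult b (G ^ (k + 1) - monom 1 (k + 1))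
      + comp_diff G R"
    by (simp only: comp_diff_add comp_diff_monom)
  then have "comp_diff G P - (monom (a * of_nat k * C) (k + e)
      + monom (a * (of_nat k * D + quad_term e C k) + b * of_nat (k + 1) * C) (k + e + 1))
    = smult a (U k) + (smult b (U (k + 1))
      + monom (b * (of_nat (k + 1) * D + quad_term e C (k + 1))) (k + 1 + e + 1)) + comp_diff G R"
    unfolding U_def
    by (simp add: smult_diff_right smult_add_right smult_monom algebra_simps add_monom[symmetric])
  moreover have "vanishes (k + e + 2) (smult b (U (k + 1)))"
    using vanishes_mono[OF U[of "k + 1"], of "k + e + 2"] b by (intro vanishes_smult) auto
  moreover have "av (b * (of_nat (k + 1) * D + quad_term e C (k + 1))) \<le> 1"
    using b C D av_of_nat_le_1
    by (intro av_mult_le_1 av_add_le_1 av_quad_term_le_1)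
  ultimately show ?thesis
    using U[of k] R a by (auto intro!: vanishes_add vanishes_smult vanishes_monom)
qed

end

section \<open>Minimal ramification of wildly ramified iterates\<close>

context ultrametric_field
begin

lemma two_term_expansion_of_iterate:
  assumes "vanishes (e + 1) (G - [:0, 1:])" and "1 \<le> e"
  shows "vanishes (e + 3)
    (G - ([:0, 1:] + monom (coeff G (e + 1)) (e + 1) + monom (coeff G (e + 2)) (e + 2)))"
proof -
  have [simp]: "coeff [:1 :: 'a:] e = 0"
    using assms(2) by (intro coeff_eq_0) simp
  have eq: "G - (X + Y + Z) = G - X - (Y + Z)" for X Y Z
    by simp
  show ?thesis
    unfolding eq using two_term_expansion[OF assms(1)] by (simp add: numeral_3_eq_3 numeral_2_eq_2)
qed

text \<open>\<open>a m\<close> and \<open>b m\<close> are the coefficients in degrees \<open>m e + 1\<close> and \<open>m e + 2\<close> of the \<open>m\<close>-th difference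
  of the identity along \<open>z + C z ^ (e + 1) + D z ^ (e + 2)\<close>.\<close>

context
  fixes p e :: nat and C D :: 'a and a b :: "nat \<Rightarrow> 'a"
  assumes p: "prime p" and residue: "av (of_nat p) < 1"
    and e: "e mod p = 1" and C: "av C = 1" and D: "av D \<le> 1"
    and D': "av (D - (if e = 1 then C\<^sup>2 else 0)) = 1"
    and a0: "a 0 = 1" and b0: "b 0 = 0"
    and a_Suc: "\<And>m. a (Suc m) = a m * of_nat (m * e + 1) * C"
    and b_Suc: "\<And>m. b (Suc m) = a m * (of_nat (m * e + 1) * D + quad_term e C (m * e + 1))
                        + b m * of_nat (m * e + 2) * C"
begin

lemma e_pos: "1 \<le> e"
  using e by (cases e) auto

lemma p_dvd_iff: "p dvd m * e + j \<longleftrightarrow> p dvd m + j"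
proof -
  have "(m * e + j) mod p = (m * (e mod p) + j) mod p"
    by (metis mod_add_left_eq mod_mult_right_eq)
  then show ?thesis
    by (simp add: e dvd_eq_mod_eq_0)
qed

lemma av_a_le_1: "av (a m) \<le> 1"
  using C av_of_nat_le_1 by (induction m) (auto simp: a0 a_Suc simp del: of_nat_add of_nat_mult of_nat_Suc intro!: av_mult_le_1)

lemma av_b_le_1: "av (b m) \<le> 1"
  using C D av_a_le_1 av_of_nat_le_1
  by (induction m) (auto simp: b0 b_Suc simp del: of_nat_add of_nat_mult of_nat_Suc
      intro!: av_mult_le_1 av_add_le_1 av_quad_term_le_1)

text \<open>Up to a power of \<open>C\<close>, \<open>a m\<close> is the product of the
  \<open>j e + 1\<close> for \<open>j < m\<close>, which is congruent to \<open>m!\<close> modulo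
  \<open>p\<close>. It stays a unit until the factor with \<open>j = p - 1\<close> enters and makes
  \<open>a p\<close> small.\<close>

lemma av_a_eq_1: "m < p \<Longrightarrow> av (a m) = 1"
proof (induction m)
  case (Suc m)
  have "\<not> p dvd m * e + 1"
    using Suc.prems p_dvd_iff[of m 1] by (auto dest: dvd_imp_le)
  then have "av (of_nat (m * e + 1)) = 1"
    by (rule av_of_nat_eq_1[OF residue p])
  with Suc C show ?case
    by (simp add: a_Suc av_mult del: of_nat_add of_nat_mult of_nat_Suc)
qed (simp add: a0)

lemma av_a_p: "av (a p) < 1"
proof -
  obtain m where m: "p = Suc m"
    using p prime_gt_0_nat[of p] by (cases p) auto
  have "p dvd m * e + 1"
    using p_dvd_iff[of m 1] by (simp add: m)
  then have "av (of_nat (m * e + 1)) < 1"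
    by (rule av_of_nat_dvd[OF residue])
  then show ?thesis
    using C av_a_le_1[of m] unfolding m a_Suc by (intro av_mult_less_1 av_mult_less_1') auto
qed

text \<open>For odd \<open>p\<close> only the last two steps of the recursion survive reduction. In
  the step to \<open>b (p - 1)\<close> the factor \<open>(p - 2) e + 2\<close> is divisible by
  \<open>p\<close> and cuts off the history, leaving \<open>a (p - 2)\<close> times
  \<open>-D\<close>, or times \<open>-(D - C^2)\<close> if \<open>e = 1\<close>. In the step to
  \<open>b p\<close> it is \<open>(p - 1) e + 1\<close> that is divisible by \<open>p\<close>, so
  \<open>b (p - 1)\<close> is merely multiplied by a unit. The prime 2 is computed by hand because
  binomials are divided by 2.\<close>

lemma av_b_p: "av (b p) = 1"
proof (cases "p = 2")
  case True
  have two: "av (of_nat n) < 1" if "even n" for n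
    using av_of_nat_dvd[OF residue] that True by simp
  have b2: "b p = C * (of_nat (e + 1) * D + quad_term e C (e + 1)) + D * of_nat (e + 2) * C"
    using True by (simp add: numeral_2_eq_2 a0 b0 a_Suc b_Suc quad_term_def binomial_eq_0 choose_two)
  have e_odd: "odd e"
    using e True by presburger
  show ?thesis
  proof (cases "e = 1")
    case True
    \<comment> \<open>The value of \<open>b 2\<close> is \<open>5 C D + C^3\<close>; it differs from
      \<open>-C (D - C^2)\<close> by \<open>6 C D\<close>, which is small.\<close>
    have "b p - C * (D - C\<^sup>2) * (- 1) = of_nat 6 * D * C"
      unfolding b2 using True by (simp add: quad_term_def choose_two algebra_simps power2_eq_square)
    moreover have "av (of_nat 6 * D * C) < 1"
      using two[of 6] C D by (intro av_mult_less_1) auto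
    ultimately have "av (b p) = 1 \<longleftrightarrow> av (C * (D - C\<^sup>2) * (- 1)) = 1"
      by (intro av_eq_1_cong) simp
    then show ?thesis
      using C D' True by (simp add: av_mult)
  next
    case False
    have "b p = of_nat (2 * e + 3) * (C * D)"
      unfolding b2 using False by (simp add: quad_term_def algebra_simps)
    moreover have "av (of_nat (2 * e + 3)) = 1"
      using True by (intro av_of_nat_eq_1[OF residue p]) simp
    ultimately show ?thesis
      using C D' False by (simp add: av_mult del: of_nat_add of_nat_mult)
  qed
next
  case False
  then have "2 < p"
    using prime_ge_2_nat[OF p] by simp
  then obtain m where "p = 2 + m"
    using le_Suc_ex[of 2 p] by auto
  then have m: "p = Suc (Suc m)"
    by simp
  have p_odd: "odd p"
    using p False prime_odd_nat[of p] \<open>2 < p\<close> by simp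
  define k k' where "k = Suc m * e + 1" and "k' = m * e + 1"
  have small: "av (of_nat n) < 1" if "p dvd n" for n
    using av_of_nat_dvd[OF residue that] .
  have k: "av (of_nat k) < 1"
    unfolding k_def using p_dvd_iff[of "Suc m" 1] by (intro small) (simp add: m)
  have k': "av (of_nat (k' + 1)) < 1"
  proof (intro small)
    show "p dvd k' + 1"
      using p_dvd_iff[of m 2] by (simp add: k'_def m)
  qed
  have "av (quad_term e C k) < 1"
  proof (cases "e = 1")
    case True
    have "p dvd k choose 2"
      unfolding k_def True using dvd_choose_prime[of 2 p] p \<open>2 < p\<close> by (simp add: m)
    then show ?thesis
      using True C small av_mult_less_1[of "of_nat (k choose 2)" "C\<^sup>2"]
      by (simp add: quad_term_def av_power)
  qed (simp add: quad_term_def)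
  moreover have "av (of_nat k * D) < 1"
    using k D by (rule av_mult_less_1)
  ultimately have top: "av (a (Suc m) * (of_nat k * D + quad_term e C k)) < 1"
    using av_mult_less_1'[OF av_a_le_1 av_add_less_1] by blast
  have "av (a m * (of_nat k' * D + quad_term e C k') + b m * of_nat (k' + 1) * C
      - a m * (D - (if e = 1 then C\<^sup>2 else 0)) * (- 1)) < 1"
  proof -
    have "av (quad_term e C k' - (if e = 1 then C\<^sup>2 else 0)) < 1"
    proof (cases "e = 1")
      case True
      \<comment> \<open>Here \<open>k' = p - 1\<close>. As \<open>(p - 1) (p - 2)\<close> is 2
        modulo \<open>p\<close> and \<open>p\<close> is odd, the binomial is 1 modulo
        \<open>p\<close>; this is where the \<open>C^2\<close> in the hypothesis on \<open>D\<close>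
        comes from.\<close>
      have "2 * (k' choose 2) = (m + 1) * m"
        unfolding k'_def True by (simp add: choose_two)
      then have "int (2 * (k' choose 2)) = int ((m + 1) * m)"
        by simp
      then have "2 * (int (k' choose 2) - 1) = int p * (int p - 3)"
        by (simp add: m algebra_simps)
      then have "int p dvd 2 * (int (k' choose 2) - 1)"
        by simp
      moreover have "coprime (int p) 2"
        using p_odd by simp
      ultimately have "int p dvd int (k' choose 2) - 1"
        by (metis coprime_dvd_mult_right_iff)
      then obtain r where r: "int (k' choose 2) - 1 = int p * r"
        by (elim dvdE)
      then have "(of_int (int (k' choose 2) - 1) :: 'a) = of_int (int p * r)"
        by simp
      then have "(of_nat (k' choose 2) :: 'a) = 1 + of_nat p * of_int r"
        by (simp add: algebra_simps)
      then have "quad_term e C k' - C\<^sup>2 = of_nat p * of_int r * C\<^sup>2"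
        using True by (simp add: quad_term_def algebra_simps)
      moreover have "av (of_nat p * of_int r * C\<^sup>2) < 1"
        using residue C by (intro av_mult_less_1) (auto simp: av_power)
      ultimately show ?thesis
        using True by simp
    qed (simp add: quad_term_def)
    moreover have "av (of_nat (k' + 1) * D) < 1"
      using k' D by (rule av_mult_less_1)
    ultimately have "av (a m * (of_nat (k' + 1) * D
         + (quad_term e C k' - (if e = 1 then C\<^sup>2 else 0)))) < 1"
      using av_mult_less_1'[OF av_a_le_1 av_add_less_1] by blast
    moreover have "av (b m * of_nat (k' + 1) * C) < 1"
      using k' C av_b_le_1 by (intro av_mult_less_1 av_mult_less_1') auto
    ultimately have "av (a m * (of_nat (k' + 1) * D
         + (quad_term e C k' - (if e = 1 then C\<^sup>2 else 0))) + b m * of_nat (k' + 1) * C) < 1"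
      by (rule av_add_less_1)
    then show ?thesis
      by (simp add: algebra_simps)
  qed
  then have "av (b (Suc m) - a m * (D - (if e = 1 then C\<^sup>2 else 0)) * (- 1)) < 1"
    by (simp add: b_Suc k'_def numeral_2_eq_2)
  then have "av (b (Suc m)) = 1"
    using av_eq_1_cong D' av_a_eq_1[of m] by (fastforce simp: m av_mult)
  moreover have "av (of_nat (k + 1)) = 1"
  proof -
    have "p dvd k"
      unfolding k_def using p_dvd_iff[of "Suc m" 1] by (simp add: m)
    then have "\<not> p dvd k + 1"
      using p by (metis dvd_add_right_iff not_prime_unit nat_dvd_1_iff_1 prime_nat_iff)
    then show ?thesis
      by (rule av_of_nat_eq_1[OF residue p])
  qed
  ultimately have "av (b (Suc m) * of_nat (k + 1) * C) = 1"
    using C by (simp add: av_mult del: of_nat_add)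
  moreover have "b p - b (Suc m) * of_nat (k + 1) * C = a (Suc m) * (of_nat k * D + quad_term e C k)"
    unfolding m by (subst b_Suc) (simp add: k_def)
  ultimately show ?thesis
    using top av_eq_1_cong by metis
qed

end

text \<open>The middle binomial coefficients are divisible by \<open>p\<close>, so modulo the
  maximal ideal \<open>G^p - x\<close> is the \<open>p\<close>-th difference of the identity. Its
  coefficient \<open>a p\<close> in degree \<open>p e + 1\<close> is small while \<open>b p\<close>
  is a unit, hence the order \<open>p e + 2\<close>.\<close>

lemma exact_order_iterate_prime:
  assumes p: "prime p" and residue: "av (of_nat p) < 1" and e: "e mod p = 1"
    and G: "exact_order (e + 1) (G - [:0, 1:])"
    and unit: "av (coeff G (e + 2) - (if e = 1 then (coeff G (e + 1))\<^sup>2 else 0)) = 1"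
  shows "exact_order (p * e + 2) (iter_poly G p - [:0, 1:])"
proof -
  define C D where "C = coeff G (e + 1)" and "D = coeff G (e + 2)"
  have e_pos: "1 \<le> e"
    using e by (cases e) auto
  have GX: "vanishes (e + 1) (G - [:0, 1:])"
    using G by (simp add: exact_order_def)
  have [simp]: "coeff [:1 :: 'a:] e = 0"
    using e_pos by (intro coeff_eq_0) simp
  have C: "av C = 1"
    using G by (simp add: exact_order_def C_def)
  have D: "av D \<le> 1"
    using vanishes_coeff_le_1[OF GX, of "e + 2"] by (simp add: D_def)
  have G2: "vanishes (e + 3) (G - ([:0, 1:] + monom C (e + 1) + monom D (e + 2)))"
    unfolding C_def D_def by (rule two_term_expansion_of_iterate[OF GX e_pos])
  define ab where "ab = rec_nat (1, 0) (\<lambda>m (a, b). (a * of_nat (m * e + 1) * C,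
     a * (of_nat (m * e + 1) * D + quad_term e C (m * e + 1)) + b * of_nat (m * e + 2) * C))"
  define a b where "a m = fst (ab m)" and "b m = snd (ab m)" for m
  have a0: "a 0 = 1" and b0: "b 0 = 0"
    by (simp_all add: a_def b_def ab_def)
  have a_Suc: "a (Suc m) = a m * of_nat (m * e + 1) * C"
    and b_Suc: "b (Suc m) = a m * (of_nat (m * e + 1) * D + quad_term e C (m * e + 1))
                        + b m * of_nat (m * e + 2) * C" for m
    by (simp_all add: a_def b_def ab_def case_prod_beta)
  note ctx = p residue e C D unit[folded C_def D_def] a0 b0 a_Suc b_Suc
  define t where "t m = (comp_diff G ^^ m) [:0, 1:]" for m
  have t: "vanishes (m * e + 3) (t m - (monom (a m) (m * e + 1) + monom (b m) (m * e + 2)))" for m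
  proof (induction m)
    case 0
    then show ?case
      by (simp add: t_def a0 b0 monom_altdef)
  next
    case (Suc m)
    have "vanishes (m * e + 1 + e + 2) (comp_diff G (t m) -
        (monom (a m * of_nat (m * e + 1) * C) (m * e + 1 + e)
        + monom (a m * (of_nat (m * e + 1) * D + quad_term e C (m * e + 1))
            + b m * of_nat (m * e + 1 + 1) * C) (m * e + 1 + e + 1)))"
      using Suc C av_a_le_1[OF ctx] av_b_le_1[OF ctx]
      by (intro comp_diff_expansion[OF G2 e_pos _ D]) (simp_all add: numeral_3_eq_3)
    moreover have "t (Suc m) = comp_diff G (t m)"
      by (simp add: t_def)
    ultimately show ?case
      by (simp add: a_Suc b_Suc add_ac numeral_3_eq_3)
  qed
  have t_int: "integral_poly (t m)" for m
  proof -
    have "integral_poly (monom (a m) (m * e + 1) + monom (b m) (m * e + 2))"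
      using av_a_le_1[OF ctx] av_b_le_1[OF ctx] by (intro vanishes_add vanishes_monom) auto
    from vanishes_add[OF vanishes_imp_integral[OF t[of m]] this] show ?thesis
      by simp
  qed
  have p0: "p \<noteq> 0"
    using p by auto
  have "iter_poly G p = (\<Sum>k\<le>p. smult (of_nat (p choose k)) (t k))"
    using pcompose_iter_poly[of "[:0, 1:]" G p] by (simp add: t_def)
  also have "{..p} = insert 0 (insert p {0<..<p})"
    using p0 by auto
  also have "(\<Sum>k\<in>\<dots>. smult (of_nat (p choose k)) (t k))
      = [:0, 1:] + (t p + (\<Sum>k\<in>{0<..<p}. smult (of_nat (p choose k)) (t k)))"
    using p0 by (simp add: t_def)
  finally have it: "iter_poly G p - [:0, 1:]
      = t p + (\<Sum>k\<in>{0<..<p}. smult (of_nat (p choose k)) (t k))"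
    by simp
  have "vanishes (Suc (p * e + 2)) (\<Sum>k\<in>{0<..<p}. smult (of_nat (p choose k)) (t k))"
    using dvd_choose_prime[of _ p] p
    by (intro vanishes_sum vanishes_smult_small t_int av_of_nat_dvd[OF residue]) auto
  moreover have "vanishes (Suc (p * e + 2)) (monom (a p) (p * e + 1))"
    by (rule vanishes_monom_small[OF av_a_p[OF ctx]])
  moreover have "vanishes (Suc (p * e + 2)) (t p - (monom (a p) (p * e + 1) + monom (b p) (p * e + 2)))"
    using t[of p] by (simp add: numeral_3_eq_3)
  ultimately have "vanishes (Suc (p * e + 2))
     ((t p - (monom (a p) (p * e + 1) + monom (b p) (p * e + 2))) + monom (a p) (p * e + 1)
       + (\<Sum>k\<in>{0<..<p}. smult (of_nat (p choose k)) (t k)))"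
    by (intro vanishes_add)
  then have "vanishes (Suc (p * e + 2)) (iter_poly G p - [:0, 1:] - monom (b p) (p * e + 2))"
    unfolding it by (simp add: algebra_simps)
  moreover have "exact_order (p * e + 2) (monom (b p) (p * e + 2))"
    using av_b_p[OF ctx] by (simp add: exact_order_def vanishes_monom)
  ultimately show ?thesis
    using exact_order_cong by blast
qed

text \<open>Comparing the coefficients of \<open>x ^ (e + 3)\<close> in \<open>g \<circ> G = G \<circ> g\<close>: the second
  coefficient of an iterate is determined by the first one.\<close>

lemma commuting_second_coefficient:
  assumes comm: "g \<circ>\<^sub>p G = G \<circ>\<^sub>p g" and g: "vanishes 2 (g - [:0, 1:])"
    and G: "vanishes (e + 1) (G - [:0, 1:])" and e: "2 \<le> e"
  defines "A \<equiv> coeff g 2" and "B \<equiv> coeff g 3" and "C \<equiv> coeff G (e + 1)" and "D \<equiv> coeff G (e + 2)"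
  shows "av (2 * A * D + 3 * B * C - (C * (of_nat (e + 1) * B + of_nat ((e + 1) choose 2) * A\<^sup>2)
             + D * of_nat (e + 2) * A)) < 1"
proof -
  have [simp]: "coeff [:1 :: 'a:] e = 0"
    using e by (intro coeff_eq_0) simp
  have [simp]: "coeff [:0, 1:] 2 = (0 :: 'a)" "coeff [:0, 1:] 3 = (0 :: 'a)"
    by (auto intro!: coeff_eq_0)
  have le: "av A \<le> 1" "av B \<le> 1" "av C \<le> 1" "av D \<le> 1"
    using vanishes_coeff_le_1[OF g, of 2] vanishes_coeff_le_1[OF g, of 3]
      vanishes_coeff_le_1[OF G, of "e + 1"] vanishes_coeff_le_1[OF G, of "e + 2"]
    by (simp_all add: A_def B_def C_def D_def)
  have g2: "vanishes (1 + 3) (g - ([:0, 1:] + monom A (1 + 1) + monom B (1 + 2)))"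
    using two_term_expansion_of_iterate[of 1 g] g by (simp add: A_def B_def numeral_2_eq_2 numeral_3_eq_3)
  have G2: "vanishes (e + 3) (G - ([:0, 1:] + monom C (e + 1) + monom D (e + 2)))"
    unfolding C_def D_def by (rule two_term_expansion_of_iterate[OF G]) (use e in simp)
  have g3: "vanishes (2 + 2) (g - [:0, 1:] - (monom A 2 + monom B (2 + 1)))"
    using two_term_expansion[OF g] by (simp add: A_def B_def)
  have G3: "vanishes (e + 1 + 2) (G - [:0, 1:] - (monom C (e + 1) + monom D (e + 1 + 1)))"
    using two_term_expansion[OF G] by (simp add: C_def D_def)
  \<comment> \<open>Since \<open>g\<close> and \<open>G\<close> commute, \<open>U\<close> is
    symmetric in them: it is the difference of \<open>g - x\<close> along \<open>G\<close> and also
    that of \<open>G - x\<close> along \<open>g\<close>. Both expansions are read off in degree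
    \<open>e + 3\<close>.\<close>
  define U where "U = comp_diff G (g - [:0, 1:])"
  have "U = comp_diff g (G - [:0, 1:])"
    by (simp add: U_def comp_diff_def pcompose_diff comm)
  then have 1: "vanishes (e + 1 + 1 + 2) (U - (monom (C * of_nat (e + 1) * A) (e + 1 + 1)
       + monom (C * (of_nat (e + 1) * B + quad_term 1 A (e + 1)) + D * of_nat (e + 1 + 1) * A) (e + 1 + 1 + 1)))"
    using comp_diff_expansion[OF g2 _ le(1,2) G3 le(3,4)] by simp
  have 2: "vanishes (2 + e + 2) (U - (monom (A * of_nat 2 * C) (2 + e)
       + monom (A * (of_nat 2 * D + quad_term e C 2) + B * of_nat (2 + 1) * C) (2 + e + 1)))"
    unfolding U_def using comp_diff_expansion[OF G2 _ le(3,4) g3 le(1,2)] e by simp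
  have "av ((coeff U (e + 3) - (C * (of_nat (e + 1) * B + quad_term 1 A (e + 1)) + D * of_nat (e + 2) * A))
     - (coeff U (e + 3) - (A * (of_nat 2 * D + quad_term e C 2) + B * of_nat 3 * C))) < 1"
    using vanishesD[OF 1, of "e + 3"] vanishesD[OF 2, of "e + 3"]
    by (intro av_diff_less_1[of "_ - _" "_ - _"]) (simp_all add: numeral_3_eq_3 numeral_2_eq_2)
  then show ?thesis
    using e by (simp add: quad_term_def algebra_simps)
qed

lemma geometric_sum_Suc: "(\<Sum>i\<le>Suc n. p ^ i) = p * (\<Sum>i\<le>n. p ^ i) + (1 :: nat)"
  unfolding sum.atMost_Suc_shift by (simp add: sum_distrib_left)

lemma geometric_sum_mod:
  assumes "1 < (p :: nat)"
  shows "(\<Sum>i\<le>n. p ^ i) mod p = 1"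
proof (cases n)
  case (Suc m)
  show ?thesis
    unfolding Suc geometric_sum_Suc using assms by (simp only: mod_mult_self4) simp
qed (use assms in simp)

text \<open>Each step needs the unit condition on the second coefficient \<open>D\<close> of the
  current iterate. For \<open>n = 0\<close> it is the hypothesis. Later, as \<open>e\<close> is 1
  modulo \<open>p\<close>, commutation with \<open>g\<close> gives that \<open>D A\<close> is
  congruent to \<open>C (B - kappa A^2)\<close>, where \<open>kappa\<close> is \<open>e + 1\<close>
  over 2. It is 1 modulo \<open>p\<close> for odd \<open>p\<close> but even for
  \<open>p = 2\<close>, whence the extra condition on \<open>B\<close> there.\<close>

lemma exact_order_iterate_prime_power:
  assumes p: "prime p" and residue: "av (of_nat p) < 1"
    and g: "exact_order 2 (g - [:0, 1:])"
    and unit: "av (coeff g 3 - (coeff g 2)\<^sup>2) = 1" "p = 2 \<Longrightarrow> av (coeff g 3) = 1"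
  shows "exact_order ((\<Sum>i\<le>n. p ^ i) + 1) (iter_poly g (p ^ n) - [:0, 1:])"
proof (induction n)
  case 0
  then show ?case
    using g by (simp add: numeral_2_eq_2)
next
  case (Suc n)
  define e where "e = (\<Sum>i\<le>n. p ^ i)"
  define G where "G = iter_poly g (p ^ n)"
  define A B C D where "A = coeff g 2" and "B = coeff g 3"
    and "C = coeff G (e + 1)" and "D = coeff G (e + 2)"
  have e_mod: "e mod p = 1"
    unfolding e_def using p prime_gt_1_nat by (intro geometric_sum_mod) auto
  have GX: "exact_order (e + 1) (G - [:0, 1:])"
    using Suc by (simp add: e_def G_def)
  have e1: "e = 1 \<longleftrightarrow> n = 0"
  proof (cases n)
    case (Suc m)
    have "e = p * (\<Sum>i\<le>m. p ^ i) + 1"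
      unfolding e_def Suc geometric_sum_Suc ..
    moreover have "0 < (\<Sum>i\<le>m. p ^ i)"
      using p by (intro sum_pos) (auto simp: prime_gt_0_nat)
    ultimately show ?thesis
      using Suc p by auto
  qed (simp add: e_def)
  have "av (D - (if e = 1 then C\<^sup>2 else 0)) = 1"
  proof (cases "e = 1")
    case True
    then show ?thesis
      using e1 unit(1) by (simp add: C_def D_def G_def numeral_2_eq_2 numeral_3_eq_3)
  next
    case False
    have "1 \<le> e"
      using e_mod by (cases e) auto
    with False have e2: "2 \<le> e"
      by simp
    have "[:0, 1:] = monom (1::'a) 1"
      by (simp add: monom_altdef)
    then have A: "av A = 1"
      using g by (simp add: exact_order_def A_def)
    have B: "av B \<le> 1"
      using g vanishes_coeff_le_1[of 2 "g - [:0, 1:]" 3] \<open>[:0, 1:] = monom (1::'a) 1\<close>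
      by (simp add: exact_order_def B_def)
    have "coeff [:1 :: 'a:] e = 0"
      using e2 by (intro coeff_eq_0) simp
    then have C: "av C = 1"
      using GX by (simp add: exact_order_def C_def)
    have D: "av D \<le> 1"
      using GX vanishes_coeff_le_1[of "e + 1" "G - [:0, 1:]" "e + 2"]
        \<open>[:0, 1:] = monom (1::'a) 1\<close> by (simp add: exact_order_def D_def)
    define \<kappa> where "\<kappa> = (e + 1) choose 2"
    have "g \<circ>\<^sub>p G = G \<circ>\<^sub>p g"
      unfolding G_def by (metis iter_poly_Suc iter_poly_Suc')
    then have comm: "av (2 * A * D + 3 * B * C - (C * (of_nat (e + 1) * B + of_nat \<kappa> * A\<^sup>2)
             + D * of_nat (e + 2) * A)) < 1"
      unfolding A_def B_def C_def D_def \<kappa>_def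
      using g GX e2 by (intro commuting_second_coefficient) (auto simp: exact_order_def)
    obtain r where r: "e = 1 + p * r"
      using e_mod by (metis add.commute mod_mult_div_eq)
    have "av (D * A - C * (B - of_nat \<kappa> * A\<^sup>2)) < 1"
    proof -
      have "- (2 * A * D + 3 * B * C - (C * (of_nat (e + 1) * B + of_nat \<kappa> * A\<^sup>2)
             + D * of_nat (e + 2) * A)) - of_nat p * (of_nat r * (C * B + D * A))
          = D * A - C * (B - of_nat \<kappa> * A\<^sup>2)"
        unfolding r by (simp add: algebra_simps)
      moreover have "av (of_nat p * (of_nat r * (C * B + D * A))) < 1"
        using A B C D residue by (intro av_mult_less_1 av_mult_le_1 av_add_le_1) auto
      ultimately show ?thesis
        using comm av_diff_less_1 av_minus by metis
    qed
    then have "av (D * A) = 1 \<longleftrightarrow> av (C * (B - of_nat \<kappa> * A\<^sup>2)) = 1"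
      by (rule av_eq_1_cong)
    moreover have "av (B - of_nat \<kappa> * A\<^sup>2) = 1"
    proof (cases "p = 2")
      case True
      obtain m where m: "n = Suc m"
        using False e1 by (cases n) auto
      \<comment> \<open>Beyond the first step \<open>e = 1 + 2 + ...\<close> is 3 modulo 4, so
        \<open>(e + 1) / 2\<close> and with it \<kappa> is even.\<close>
      obtain u where "(\<Sum>i\<le>m. 2 ^ i) = 2 * u + (1 :: nat)"
        by (cases m) (auto simp only: geometric_sum_Suc, auto)
      then have e4: "e = 2 * (2 * u + 1) + 1"
        unfolding e_def m True geometric_sum_Suc by simp
      have "e + 1 = 2 * (2 * (u + 1))"
        unfolding e4 by simp
      then have "\<kappa> = 2 * (u + 1) * e"
        unfolding \<kappa>_def by (simp add: choose_two)
      then have "av (of_nat \<kappa>) < 1"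
        using True by (intro av_of_nat_dvd[OF residue]) simp
      then have "av (B - (B - of_nat \<kappa> * A\<^sup>2)) < 1"
        using A av_mult_less_1[of "of_nat \<kappa>" "A\<^sup>2"] by (simp add: av_power)
      then show ?thesis
        using av_eq_1_cong[of B "B - of_nat \<kappa> * A\<^sup>2"] unit(2) True by (simp add: B_def)
    next
      case False
      have "2 * \<kappa> = (e + 1) * e"
        unfolding \<kappa>_def by (simp add: choose_two)
      then have "int (2 * \<kappa>) = int ((e + 1) * e)"
        by simp
      then have "2 * (int \<kappa> - 1) = int p * (int r * (int e + 2))"
        by (simp add: r algebra_simps)
      then have "int p dvd 2 * (int \<kappa> - 1)"
        by simp
      moreover have "coprime (int p) 2"
        using False p prime_odd_nat[of p] prime_ge_2_nat[of p] by (simp add: le_less)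
      ultimately have "int p dvd int \<kappa> - 1"
        by (metis coprime_dvd_mult_right_iff)
      then obtain s where s: "int \<kappa> - 1 = int p * s"
        by (elim dvdE)
      then have "(of_int (int \<kappa> - 1) :: 'a) = of_int (int p * s)"
        by simp
      then have "(of_nat \<kappa> :: 'a) = 1 + of_nat p * of_int s"
        by (simp add: algebra_simps)
      then have "(B - A\<^sup>2) - (B - of_nat \<kappa> * A\<^sup>2) = of_nat p * (of_int s * A\<^sup>2)"
        by (simp add: algebra_simps)
      moreover have "av (of_nat p * (of_int s * A\<^sup>2)) < 1"
        using A residue by (intro av_mult_less_1 av_mult_le_1) (auto simp: av_power)
      ultimately show ?thesis
        using av_eq_1_cong unit(1) by (metis A_def B_def)
    qed
    ultimately show ?thesis
      using False A C by (simp add: av_mult)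
  qed
  then have "exact_order (p * e + 2) (iter_poly G p - [:0, 1:])"
    unfolding C_def D_def by (rule exact_order_iterate_prime[OF p residue e_mod GX])
  then show ?case
    unfolding geometric_sum_Suc by (simp add: G_def iter_poly_mult e_def mult.commute)
qed

end

section \<open>Cycles of integral polynomials in the open unit disc\<close>

text \<open>On a cycle an iterate can be undone by running on to step \<open>N\<close>.\<close>

lemma funpow_fixed_shift:
  assumes "(f ^^ N) z = z" "(f ^^ (i + d)) z = (f ^^ i) z" "i \<le> N"
  shows "(f ^^ d) z = z"
proof -
  have "(f ^^ d) z = (f ^^ (d + N)) z"
    by (simp add: funpow_add assms(1))
  also have "d + N = (N - i) + (i + d)"
    using assms(3) by simp
  also have "(f ^^ \<dots>) z = (f ^^ (N - i)) ((f ^^ i) z)"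
    by (simp only: funpow_add[of "N - i"] o_apply assms(2))
  also have "\<dots> = (f ^^ ((N - i) + i)) z"
    by (simp only: funpow_add o_apply)
  finally show ?thesis
    using assms(1,3) by simp
qed

lemma poly_pderiv_iter_poly_fixpoint:
  assumes "poly G z = z"
  shows "poly (pderiv (iter_poly G n)) z = poly (pderiv G) z ^ n"
  using assms by (induction n) (simp_all add: iter_poly_Suc' pderiv_pcompose poly_pcompose pderiv_pCons mult.commute)

lemma iter_poly_coeff_0: "coeff f 0 = 0 \<Longrightarrow> coeff (iter_poly f n) 0 = 0"
  by (induction n) (simp_all add: iter_poly_Suc poly_0_coeff_0)

lemma iter_poly_coeff_1: "coeff f 0 = 0 \<Longrightarrow> coeff (iter_poly f n) (Suc 0) = coeff f (Suc 0) ^ n"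
  for f :: "'a::idom poly"
proof (induction n)
  case (Suc n)
  obtain a b R where f: "f = pCons a (pCons b R)"
    by (metis pCons_cases)
  then have "a = 0"
    using Suc.prems by simp
  have "coeff (iter_poly f n) 0 = 0"
    using Suc.prems by (rule iter_poly_coeff_0)
  then show ?case
    using Suc \<open>a = 0\<close> by (simp add: f iter_poly_Suc pcompose_pCons coeff_mult)
qed simp

context ultrametric_field
begin

lemma av_poly_le_1: "integral_poly P \<Longrightarrow> av z \<le> 1 \<Longrightarrow> av (poly P z) \<le> 1"
  unfolding poly_altdef
  by (intro av_sum_le av_mult_le_1 av_power_le_1) (auto simp: vanishes_def)

lemma av_poly_linear_approx:
  assumes P: "integral_poly P" "coeff P 0 = 0" and z: "av z \<le> 1"
  shows "av (poly P z - coeff P (Suc 0) * z) \<le> av z ^ 2"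
proof -
  obtain a b R where PR: "P = pCons a (pCons b R)"
    by (metis pCons_cases)
  have "integral_poly R"
    unfolding integral_poly_def
  proof
    show "av (coeff R i) \<le> 1" for i
      using vanishes_coeff_le_1[OF P(1), of "Suc (Suc i)"] by (simp add: PR)
  qed
  then have "av (poly R z) \<le> 1"
    using z by (rule av_poly_le_1)
  moreover have "poly P z - coeff P (Suc 0) * z = z * z * poly R z"
    using P(2) by (simp add: PR algebra_simps)
  ultimately show ?thesis
    by (simp add: av_mult power2_eq_square mult_left_le)
qed

lemma integral_iter_poly: "integral_poly f \<Longrightarrow> integral_poly (iter_poly f n)"
  by (induction n) (auto simp: iter_poly_Suc intro: integral_pcompose)

text \<open>This is the difference quotient of \<open>P\<close> between \<open>G\<close> and
  \<open>x\<close>, with integral coefficients by Horner induction. At a fixed point of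
  \<open>G\<close> the two arguments coincide, which leaves the derivative.\<close>

lemma comp_diff_quotient:
  assumes P: "integral_poly P" and G: "integral_poly G"
  shows "\<exists>Q. integral_poly Q \<and> comp_diff G P = (G - [:0, 1:]) * Q \<and>
             (\<forall>z. poly G z = z \<longrightarrow> poly Q z = poly (pderiv P) z)"
  using P
proof (induction P)
  case 0
  then show ?case
    by (intro exI[of _ 0]) (simp add: comp_diff_def)
next
  case (pCons a P)
  have P: "integral_poly P"
    unfolding integral_poly_def
  proof
    show "av (coeff P i) \<le> 1" for i
      using vanishes_coeff_le_1[OF pCons.prems, of "Suc i"] by simp
  qed
  then obtain Q where Q: "integral_poly Q" "comp_diff G P = (G - [:0, 1:]) * Q"
    "\<And>z. poly G z = z \<Longrightarrow> poly Q z = poly (pderiv P) z"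
    using pCons.IH by blast
  have "comp_diff G (pCons a P) = (G - [:0, 1:]) * (P \<circ>\<^sub>p G) + [:0, 1:] * comp_diff G P"
    by (simp add: comp_diff_def pcompose_pCons algebra_simps)
  also have "\<dots> = (G - [:0, 1:]) * (P \<circ>\<^sub>p G + [:0, 1:] * Q)"
    unfolding Q(2) by (simp only: distrib_left mult.left_commute)
  finally have "comp_diff G (pCons a P) = (G - [:0, 1:]) * (P \<circ>\<^sub>p G + [:0, 1:] * Q)" .
  moreover have "integral_poly (P \<circ>\<^sub>p G + [:0, 1:] * Q)"
    using P G Q(1) integral_X by (intro vanishes_add integral_pcompose integral_mult)
  moreover have "poly (P \<circ>\<^sub>p G + [:0, 1:] * Q) z = poly (pderiv (pCons a P)) z" if "poly G z = z" for z
    using Q(3)[OF that] that by (simp add: poly_pcompose pderiv_pCons)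
  ultimately show ?case
    by blast
qed

text \<open>Telescope into the differences of the iterates of \<open>G\<close>. The geometric sum in
  the multiplier is what later turns a common zero into a root of unity.\<close>

lemma iter_poly_quotient:
  assumes G: "integral_poly G"
  obtains H where "integral_poly H" "iter_poly G p - [:0, 1:] = (G - [:0, 1:]) * H"
    "\<And>z. poly G z = z \<Longrightarrow> poly H z = (\<Sum>i<p. poly (pderiv G) z ^ i)"
proof -
  have "\<exists>Q. integral_poly Q \<and> comp_diff G (iter_poly G i) = (G - [:0, 1:]) * Q \<and>
             (\<forall>z. poly G z = z \<longrightarrow> poly Q z = poly (pderiv G) z ^ i)" for i
    using comp_diff_quotient[OF integral_iter_poly[OF G, of i] G]
    by (metis poly_pderiv_iter_poly_fixpoint)
  then obtain Q where Q: "\<And>i. integral_poly (Q i)"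
      "\<And>i. comp_diff G (iter_poly G i) = (G - [:0, 1:]) * Q i"
      "\<And>i z. poly G z = z \<Longrightarrow> poly (Q i) z = poly (pderiv G) z ^ i"
    by metis
  have "iter_poly G p - [:0, 1:] = (\<Sum>i<p. iter_poly G (Suc i) - iter_poly G i)"
    by (simp add: sum_lessThan_telescope)
  also have "\<dots> = (\<Sum>i<p. comp_diff G (iter_poly G i))"
    by (simp add: comp_diff_def iter_poly_Suc')
  also have "\<dots> = (G - [:0, 1:]) * (\<Sum>i<p. Q i)"
    unfolding Q(2) by (rule sum_distrib_left[symmetric])
  finally have "iter_poly G p - [:0, 1:] = (G - [:0, 1:]) * (\<Sum>i<p. Q i)" .
  then show ?thesis
    using Q by (intro that[of "\<Sum>i<p. Q i"]) (auto intro: vanishes_sum simp: poly_sum)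
qed

text \<open>Contrapositive, by splitting off roots: if all roots have absolute value at least 1,
  each linear factor scales the constant coefficient by at least as much as it can enlarge any other
  one.\<close>

lemma root_in_open_disc:
  assumes alg: "alg_closed_field TYPE('a)" and less: "av (coeff H 0) < av (coeff H k)"
  obtains z where "poly H z = 0" "av z < 1"
proof -
  have "av (coeff H k) \<le> av (coeff H 0)" if "\<And>z. poly H z = 0 \<Longrightarrow> 1 \<le> av z" for k
    using that
  proof (induction "degree H" arbitrary: H k rule: less_induct)
    case less
    show ?case
    proof (cases "degree H = 0")
      case True
      then show ?thesis
        by (cases "k = 0") (simp_all add: coeff_eq_0)
    next
      case False
      then obtain r where r: "poly H r = 0"
        using alg by (auto simp: alg_closed_field_def)
      then obtain Q where H: "H = [:- r, 1:] * Q"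
        by (auto simp: poly_eq_0_iff_dvd)
      with False have "Q \<noteq> 0"
        by auto
      then have "degree Q < degree H"
        unfolding H by (subst degree_mult_eq) auto
      moreover have "1 \<le> av z" if "poly Q z = 0" for z
        using less.prems[of z] that by (simp add: H)
      ultimately have IH: "av (coeff Q k) \<le> av (coeff Q 0)" for k
        by (rule less.hyps)
      have r1: "1 \<le> av r"
        using less.prems r .
      have H0: "av (coeff H 0) = av r * av (coeff Q 0)"
        by (simp add: H av_mult)
      show ?thesis
      proof (cases k)
        case (Suc j)
        have "av (coeff H k) \<le> max (av (r * coeff Q (Suc j))) (av (coeff Q j))"
          using av_diff_le[of "coeff Q j" "r * coeff Q (Suc j)"] by (simp add: H Suc max.commute)
        also have "\<dots> \<le> av r * av (coeff Q 0)"
          using IH[of "Suc j"] IH[of j] r1 mult_mono[of 1 "av r" "av (coeff Q j)" "av (coeff Q 0)"]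
          by (auto simp: av_mult mult_left_mono)
        finally show ?thesis
          by (simp add: H0)
      qed simp
    qed
  qed
  then show ?thesis
    using less that by (meson not_le)
qed

text \<open>Synthetic division from the top degree downwards never leaves the valuation
  ring.\<close>

lemma integral_linear_quotient:
  assumes H: "integral_poly ([:- a, 1:] * Q)" and a: "av a \<le> 1"
  shows "integral_poly Q"
  unfolding integral_poly_def
proof
  fix k
  have step: "av (coeff Q k) \<le> 1" if "av (coeff Q (Suc k)) \<le> 1" for k
  proof -
    have *: "coeff Q k = coeff ([:- a, 1:] * Q) (Suc k) + a * coeff Q (Suc k)"
      by simp
    show ?thesis
      by (subst *) (rule av_add_le_1[OF vanishes_coeff_le_1[OF H] av_mult_le_1[OF a that]])
  qed
  show "av (coeff Q k) \<le> 1"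
  proof (cases "k \<le> degree Q")
    case True
    then show ?thesis
    proof (induction k rule: inc_induct)
      case base
      show ?case
        by (rule step) (simp add: coeff_eq_0)
    qed (rule step)
  qed (simp add: coeff_eq_0)
qed

lemma factor_roots:
  assumes "finite A" and "integral_poly H" and "\<And>a. a \<in> A \<Longrightarrow> poly H a = 0 \<and> av a < 1"
  shows "\<exists>E. integral_poly E \<and> H = E * (\<Prod>a\<in>A. [:- a, 1:])"
  using assms(1,3)
proof (induction A rule: finite_induct)
  case empty
  then show ?case
    using assms(2) by (intro exI[of _ H]) simp
next
  case (insert a A)
  then obtain E where E: "integral_poly E" "H = E * (\<Prod>a\<in>A. [:- a, 1:])"
    by auto
  have "poly (\<Prod>a\<in>A. [:- a, 1:]) a \<noteq> 0"
    using insert.hyps by (auto simp: poly_prod)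
  then have "poly E a = 0"
    using insert.prems[of a] E(2) by simp
  then obtain E' where E': "E = [:- a, 1:] * E'"
    by (auto simp: poly_eq_0_iff_dvd)
  have "av a \<le> 1"
    using insert.prems[of a] by simp
  with E(1) have "integral_poly E'"
    unfolding E' by (rule integral_linear_quotient)
  moreover have "H = E' * (\<Prod>a\<in>insert a A. [:- a, 1:])"
    unfolding E(2) E' prod.insert[OF insert.hyps] by (simp only: mult_ac)
  ultimately show ?case
    by blast
qed

lemma exact_order_prod_linear:
  assumes "finite A" "\<And>a. a \<in> A \<Longrightarrow> av a < 1"
  shows "exact_order (card A) (\<Prod>a\<in>A. [:- a, 1:])"
  using assms
proof (induction A rule: finite_induct)
  case empty
  then show ?case
    by (simp add: exact_order_def)
next
  case (insert a A)
  have "exact_order 1 [:- a, 1:]"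
    using insert.prems[of a]
    by (auto simp: exact_order_def vanishes_def coeff_pCons split: nat.splits)
  from exact_order_mult[OF this insert.IH] show ?case
    using insert by simp
qed

text \<open>The linear factors of \<open>A\<close> use up the whole order of \<open>H\<close>, so
  the cofactor has order 0, that is, a unit as constant coefficient.\<close>

lemma av_coeff_0_eq_prod_roots:
  assumes H: "exact_order (card A) H" and A: "finite A" "\<And>a. a \<in> A \<Longrightarrow> poly H a = 0 \<and> av a < 1"
  shows "av (coeff H 0) = (\<Prod>a\<in>A. av a)"
proof -
  have int: "integral_poly H"
    using H by (auto simp: exact_order_def intro: vanishes_imp_integral)
  obtain E where E: "integral_poly E" "H = E * (\<Prod>a\<in>A. [:- a, 1:])"
    using factor_roots[OF A(1) int A(2)] by blast
  have "exact_order 0 E"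
    using exact_order_cancel[of 0 "card A" E] exact_order_prod_linear[OF A(1)] H E A(2) by auto
  then have "av (coeff E 0) = 1"
    by (simp add: exact_order_def)
  moreover have "coeff H 0 = coeff E 0 * (\<Prod>a\<in>A. - a)"
    unfolding E(2) by (simp add: coeff_mult_0 poly_0_coeff_0[symmetric] poly_prod)
  ultimately show ?thesis
    by (simp add: av_mult av_prod)
qed

text \<open>With \<open>N = q p^n\<close> and \<open>N' = q p^(n-1)\<close>, let \<open>H\<close> be
  the quotient of the two iterates minus \<open>x\<close>. Cancelling orders gives it order
  \<open>N\<close>. Comparing linear coefficients gives its constant coefficient, which is the very
  quotient in the definition of an optimal cycle.\<close>

theorem optimal_cycle_if_exact_order:
  assumes alg: "alg_closed_field TYPE('a)" and p: "prime p" and q: "0 < q" and n: "1 \<le> n"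
    and f: "integral_poly f" "coeff f 0 = 0" "coeff f 1 = lam" and lam: "av lam = 1"
    and order: "\<And>d. \<not> q dvd d \<Longrightarrow> av (lam ^ d - 1) = 1"
    and not_root_of_unity: "\<And>k. 0 < k \<Longrightarrow> lam ^ k \<noteq> 1"
    and exact: "exact_order (q * p ^ n + r) (iter_poly f (q * p ^ n) - [:0, 1:])"
      "exact_order r (iter_poly f (q * p ^ (n - 1)) - [:0, 1:])"
    and multiplier: "\<And>z L. 0 < L \<Longrightarrow> poly (iter_poly f L) z = z \<Longrightarrow>
                        poly (pderiv (iter_poly f L)) z ^ p \<noteq> 1"
  shows "optimal_cycle av (poly f) lam q p n"
proof -
  define N N' where "N = q * p ^ n" and "N' = q * p ^ (n - 1)"
  have N: "N = N' * p"
    using n by (cases n) (simp_all add: N_def N'_def)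
  have p1: "1 < p"
    using p by (rule prime_gt_1_nat)
  have N'_pos: "0 < N'" and N_pos: "0 < N"
    using p1 q by (auto simp: N'_def N_def)
  define G where "G = iter_poly f N'"
  have G: "integral_poly G"
    unfolding G_def using f(1) by (rule integral_iter_poly)
  obtain H where H: "integral_poly H" "iter_poly G p - [:0, 1:] = (G - [:0, 1:]) * H"
    "\<And>z. poly G z = z \<Longrightarrow> poly H z = (\<Sum>i<p. poly (pderiv G) z ^ i)"
    using iter_poly_quotient[OF G] by metis
  have FH: "iter_poly f N - [:0, 1:] = H * (G - [:0, 1:])"
    using H(2) by (simp add: G_def iter_poly_mult N mult.commute)
  have "exact_order (N + r) (iter_poly f N - [:0, 1:])" "exact_order r (G - [:0, 1:])"
    using exact by (simp_all add: N_def G_def N'_def)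
  then have Hex: "exact_order N H"
    unfolding FH by (rule exact_order_cancel[OF _ H(1)])
  have "coeff (iter_poly f N - [:0, 1:]) (Suc 0) = coeff H 0 * coeff (G - [:0, 1:]) (Suc 0)"
    unfolding FH using f(2) by (simp add: coeff_mult iter_poly_coeff_0 G_def)
  then have "lam ^ N - 1 = coeff H 0 * (lam ^ N' - 1)"
    using f(2,3) by (simp add: iter_poly_coeff_1 G_def)
  then have H0: "coeff H 0 = (lam ^ N - 1) / (lam ^ N' - 1)"
    using not_root_of_unity[OF N'_pos] by (simp add: field_simps)
  obtain z where z: "poly H z = 0" "av z < 1"
    using Hex N_pos by (auto simp: exact_order_def vanishes_def intro: root_in_open_disc[OF alg, of H N])
  have z0: "z \<noteq> 0"
    using z(1) H0 not_root_of_unity[OF N'_pos] not_root_of_unity[OF N_pos]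
    by (auto simp: poly_0_coeff_0)
  have iter: "(poly f ^^ k) x = poly (iter_poly f k) x" for k x
    by (simp add: poly_iter_poly)
  \<comment> \<open>Near 0 every iterate is its linear part up to a quadratic error. As
    \<open>lam\<close> is a unit, orbits keep their absolute value, and as its reduction has order
    \<open>q\<close>, every period of a nonzero point of the disc is divisible by
    \<open>q\<close>.\<close>
  have approx: "av ((poly f ^^ k) x - lam ^ k * x) \<le> av x ^ 2" if "av x \<le> 1" for k x
    using av_poly_linear_approx[OF integral_iter_poly[OF f(1)] iter_poly_coeff_0[OF f(2)] that, of k]
      f(2,3) by (simp add: iter iter_poly_coeff_1)
  have av_orbit: "av ((poly f ^^ k) z) = av z" for k
  proof -
    have "av z ^ 2 < av z"
      using z z0 by (simp add: power2_eq_square)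
    then have "av ((poly f ^^ k) z - lam ^ k * z) < av (lam ^ k * z)"
      using approx[of z k] z(2) lam by (simp add: av_mult av_power)
    from av_add_eq[OF this] show ?thesis
      using lam by (simp add: av_mult av_power)
  qed
  have perN: "(poly f ^^ N) z = z"
  proof -
    have "poly (iter_poly f N - [:0, 1:]) z = 0"
      unfolding FH using z(1) by simp
    then show ?thesis
      by (simp add: iter)
  qed
  have q_dvd: "q dvd d" if "(poly f ^^ d) z = z" for d
  proof (rule ccontr)
    assume "\<not> q dvd d"
    then have "av (lam ^ d - 1) = 1"
      by (rule order)
    then have "av (z - lam ^ d * z) = av z"
      using av_mult[of "lam ^ d - 1" z] by (simp add: av_minus_commute algebra_simps)
    then have "av z \<le> av z ^ 2"
      using approx[of z d] z(2) that by simp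
    moreover have "av z ^ 2 < av z"
      using z z0 by (simp add: power2_eq_square)
    ultimately show False
      by simp
  qed
  have not_N': "(poly f ^^ N') z \<noteq> z"
  proof
    assume "(poly f ^^ N') z = z"
    then have Gz: "poly G z = z"
      by (simp add: G_def iter)
    define \<nu> where "\<nu> = poly (pderiv G) z"
    have "(\<Sum>i<p. \<nu> ^ i) = 0"
      using H(3)[OF Gz] z(1) by (simp add: \<nu>_def)
    then have "\<nu> ^ p = 1"
      using power_diff_1_eq[of \<nu> p] by simp
    then show False
      using multiplier[OF N'_pos, of z] Gz by (simp add: G_def \<nu>_def)
  qed
  have not_smaller: "(poly f ^^ j) z \<noteq> z" if j: "1 \<le> j" "j < N" for j
  proof
    assume jz: "(poly f ^^ j) z = z"
    \<comment> \<open>The gcd is again a period, so it has the form \<open>q p^i\<close>; being less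
      than \<open>N\<close> it divides \<open>N'\<close>, which is already excluded.\<close>
    define d where "d = gcd j N"
    have mult: "(poly f ^^ (j * k)) z = z" for k
      using jz by (induction k) (simp_all add: funpow_add)
    have d_pos: "0 < d"
      using j by (simp add: d_def)
    obtain u v where uv: "j * u = N * v + d"
      using bezout_nat[of j N] j by (auto simp: d_def)
    have "(poly f ^^ (N * v)) z = z" for v
      using perN by (induction v) (simp_all add: funpow_add)
    then have dz: "(poly f ^^ d) z = z"
      using mult[of u] unfolding uv by (simp add: add.commute[of "N * v"] funpow_add)
    obtain m where m: "d = q * m"
      using q_dvd[OF dz] by (elim dvdE)
    have "d dvd N"
      by (simp add: d_def)
    then have "m dvd p ^ n"
      using q by (simp add: m N_def)
    then obtain i where i: "i \<le> n" "m = p ^ i"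
      using divides_primepow_nat[OF p] by blast
    have "d < N"
      using j by (metis d_def gcd_le1_nat le_less_trans not_one_le_zero)
    then have "i < n"
      using i by (auto simp: m N_def le_less)
    then have "d dvd N'"
      unfolding m i(2) N'_def by (intro mult_dvd_mono le_imp_power_dvd) auto
    then obtain k where "N' = d * k"
      by (elim dvdE)
    moreover have "(poly f ^^ (d * k)) z = z"
      using dz by (induction k) (simp_all add: funpow_add)
    ultimately show False
      using not_N' by simp
  qed
  \<comment> \<open>The orbit consists of \<open>N\<close> distinct zeros of \<open>H\<close> of
    equal absolute value. They are all of its zeros in the open disc, so the constant coefficient
    has absolute value \<open>av z ^ N\<close>.\<close>
  define A where "A = (\<lambda>i. (poly f ^^ i) z) ` {..<N}"
  have inj: "inj_on (\<lambda>i. (poly f ^^ i) z) {..<N}"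
  proof (rule linorder_inj_onI)
    fix i j assume ij: "i < j" "i \<in> {..<N}" "j \<in> {..<N}"
    then have "(poly f ^^ (j - i)) z \<noteq> z"
      by (intro not_smaller) auto
    then show "(poly f ^^ i) z \<noteq> (poly f ^^ j) z"
      using funpow_fixed_shift[OF perN, of i "j - i"] ij by auto
  qed auto
  have card: "card A = N"
    unfolding A_def using inj by (simp add: card_image)
  have roots: "poly H a = 0 \<and> av a < 1" if a: "a \<in> A" for a
  proof -
    obtain i where i: "i < N" "a = (poly f ^^ i) z"
      using a by (auto simp: A_def)
    have "(poly f ^^ N) a = a"
      unfolding i(2) using perN by (metis add.commute comp_apply funpow_add)
    then have "poly H a * (poly G a - a) = 0"
      using arg_cong[OF FH, of "\<lambda>P. poly P a"] by (simp add: iter)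
    moreover have "poly G a \<noteq> a"
    proof
      assume "poly G a = a"
      then have "(poly f ^^ (i + N')) z = (poly f ^^ i) z"
        by (simp add: G_def i(2) iter[symmetric] funpow_add[THEN fun_cong, unfolded o_apply, symmetric] add.commute)
      then show False
        using funpow_fixed_shift[OF perN] i(1) not_N' by (meson less_imp_le)
    qed
    ultimately show ?thesis
      using av_orbit z(2) i(2) by simp
  qed
  have "av (coeff H 0) = (\<Prod>a\<in>A. av a)"
    using Hex roots by (intro av_coeff_0_eq_prod_roots) (simp_all add: card, simp add: A_def)
  also have "\<dots> = av z ^ N"
    using inj by (simp add: A_def prod.reindex av_orbit)
  finally have "root N (av ((lam ^ N - 1) / (lam ^ N' - 1))) = av z"
    using N_pos by (simp add: H0[symmetric] real_root_power_cancel)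
  moreover have "min_periodic (poly f) z N"
    using N_pos perN not_smaller by (simp add: min_periodic_def)
  ultimately show ?thesis
    using z(2) not_root_of_unity[OF N_pos]
    by (auto simp: optimal_cycle_def N_def N'_def)
qed

end

section \<open>The polynomial \<open>\<lambda>z (1 + z\<^sup>q + b z\<^sup>2\<^sup>q)\<close>\<close>

definition cycle_poly :: "'a::comm_ring_1 \<Rightarrow> 'a \<Rightarrow> nat \<Rightarrow> 'a poly" where
  "cycle_poly lam b q = monom lam 1 * (1 + monom 1 q + monom b (2 * q))"

text \<open>Under \<open>w = z ^ q\<close>, \<open>cycle_poly lam b q\<close> is semiconjugate to \<open>cycle_poly_quotient lam b q\<close>,
  whose multiplier reduces to 1.\<close>

definition cycle_poly_quotient :: "'a::comm_ring_1 \<Rightarrow> 'a \<Rightarrow> nat \<Rightarrow> 'a poly" where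
  "cycle_poly_quotient lam b q = monom (lam ^ q) 1 * [:1, 1, b:] ^ q"

lemma pcompose_power: "(P ^ n) \<circ>\<^sub>p G = (P \<circ>\<^sub>p G) ^ n"
  by (induction n) (simp_all add: pcompose_mult pcompose_1)

lemma cycle_poly_semiconj:
  "iter_poly (cycle_poly lam b q) n ^ q
     = iter_poly (cycle_poly_quotient lam b q) n \<circ>\<^sub>p monom 1 q"
proof (induction n)
  case 0
  then show ?case
    by (simp add: monom_altdef)
next
  case (Suc n)
  let ?f = "cycle_poly lam b q" and ?g = "cycle_poly_quotient lam b q"
  have "[:1, 1, b:] \<circ>\<^sub>p monom 1 q = 1 + monom 1 q + monom b (2 * q)"
    by (simp add: pcompose_pCons algebra_simps mult_monom smult_monom one_pCons mult_2
        mult_2_right monom_altdef power_add)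
  then have semi: "?f ^ q = ?g \<circ>\<^sub>p monom 1 q"
    by (simp add: cycle_poly_def cycle_poly_quotient_def power_mult_distrib pcompose_mult
        pcompose_power pcompose_monom monom_power smult_monom)
  have "iter_poly ?f (Suc n) ^ q = (?f ^ q) \<circ>\<^sub>p iter_poly ?f n"
    by (simp add: iter_poly_Suc pcompose_power)
  also have "\<dots> = ?g \<circ>\<^sub>p (monom 1 q \<circ>\<^sub>p iter_poly ?f n)"
    by (simp add: semi pcompose_assoc)
  also have "monom 1 q \<circ>\<^sub>p iter_poly ?f n = iter_poly ?g n \<circ>\<^sub>p monom 1 q"
    using Suc by (simp add: pcompose_monom)
  finally show ?case
    by (simp add: iter_poly_Suc pcompose_assoc)
qed

lemma coeff_quadratic_power:
  fixes b :: "'a::comm_ring_1"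
  shows "coeff ([:1, 1, b:] ^ q) 0 = 1" "coeff ([:1, 1, b:] ^ q) 1 = of_nat q"
    "coeff ([:1, 1, b:] ^ q) 2 = of_nat q * b + of_nat (q choose 2)"
proof -
  show 0: "coeff ([:1, 1, b:] ^ q) 0 = 1" for q
    by (induction q) simp_all
  show 1: "coeff ([:1, 1, b:] ^ q) 1 = of_nat q" for q
    using 0 by (induction q) (simp_all add: mult_pCons_left)
  show "coeff ([:1, 1, b:] ^ q) 2 = of_nat q * b + of_nat (q choose 2)"
  proof (induction q)
    case (Suc q)
    then show ?case
      using 0[of q] 1[of q] by (simp add: mult_pCons_left numeral_2_eq_2 algebra_simps)
  qed (simp add: binomial_eq_0)
qed

lemma
  fixes lam b :: "'a::comm_ring_1"
  assumes "0 < q"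
  shows cycle_poly_coeff_0: "coeff (cycle_poly lam b q) 0 = 0"
    and cycle_poly_coeff_1: "coeff (cycle_poly lam b q) 1 = lam"
    and degree_cycle_poly_le: "degree (cycle_poly lam b q) \<le> 2 * q + 1"
proof -
  have *: "cycle_poly lam b q = pCons 0 (smult lam (1 + monom 1 q + monom b (2 * q)))"
    by (simp add: cycle_poly_def monom_altdef)
  show "coeff (cycle_poly lam b q) 0 = 0" "coeff (cycle_poly lam b q) 1 = lam"
    using assms by (simp_all add: *)
  have "degree (1 + monom 1 q + monom b (2 * q)) \<le> 2 * q"
    by (rule degree_le) simp
  then show "degree (cycle_poly lam b q) \<le> 2 * q + 1"
    unfolding * using degree_pCons_le[of 0 "smult lam (1 + monom 1 q + monom b (2 * q))"]
      degree_smult_le[of lam "1 + monom 1 q + monom b (2 * q)"] by linarith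
qed

context ultrametric_field
begin

lemma integral_cycle_poly:
  assumes "av lam \<le> 1" "av b \<le> 1"
  shows "integral_poly (cycle_poly lam b q)"
  unfolding cycle_poly_def using assms
  by (intro integral_mult vanishes_add vanishes_monom integral_1) auto

text \<open>To leading order iteration is additive: \<open>G^j - x\<close> agrees with
  \<open>j (G - x)\<close> up to order \<open>e + 2\<close>, since a difference of something of
  order \<open>e + 1\<close> has order \<open>2 e + 1\<close>.\<close>

lemma exact_order_iterate_coprime:
  assumes G: "exact_order (e + 1) (G - [:0, 1:])" and e: "1 \<le> e" and j: "av (of_nat j) = 1"
  shows "exact_order (e + 1) (iter_poly G j - [:0, 1:])"
proof -
  have GX: "vanishes (e + 1) (G - [:0, 1:])"
    using G by (simp add: exact_order_def)
  have main: "vanishes (e + 2) (iter_poly G j - [:0, 1:] - smult (of_nat j) (G - [:0, 1:]))" for j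
  proof (induction j)
    case (Suc j)
    let ?R = "iter_poly G j - [:0, 1:]"
    have "vanishes (e + 1) (?R - smult (of_nat j) (G - [:0, 1:]) + smult (of_nat j) (G - [:0, 1:]))"
      by (intro vanishes_add vanishes_mono[OF Suc] vanishes_smult GX) auto
    then have "vanishes (e + 1) ?R"
      by (simp only: diff_add_cancel)
    from vanishes_mono[OF vanishes_comp_diff[OF this GX], of "e + 2"]
    have "vanishes (e + 2) (comp_diff G ?R)"
      using e by simp
    moreover have "iter_poly G (Suc j) - [:0, 1:] - smult (of_nat (Suc j)) (G - [:0, 1:])
        = (?R - smult (of_nat j) (G - [:0, 1:])) + comp_diff G ?R"
      unfolding iter_poly_Suc' of_nat_Suc smult_add_left comp_diff_def pcompose_diff pcompose_X
      by simp
    ultimately show ?case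
      using Suc by (simp only: vanishes_add)
  qed simp
  have "exact_order (e + 1) (smult (of_nat j) (G - [:0, 1:]))"
    using G j unfolding exact_order_def
    by (simp only: coeff_smult av_mult) (simp add: vanishes_smult)
  then show ?thesis
    using exact_order_cong[of "e + 1" "iter_poly G j - [:0, 1:]" "smult (of_nat j) (G - [:0, 1:])"]
      main[of j] by simp
qed

lemma vanishes_pcompose_monom:
  assumes "vanishes k P"
  shows "vanishes (k * q) (P \<circ>\<^sub>p monom 1 q)"
  unfolding pcompose_expand
proof (rule vanishes_sum)
  fix i
  show "vanishes (k * q) (smult (coeff P i) (monom 1 q ^ i))"
  proof (cases "i < k")
    case True
    then show ?thesis
      using assms by (intro vanishes_smult_small integral_power vanishes_monom) (auto dest: vanishesD)
  next
    case False
    then show ?thesis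
      using assms unfolding monom_power
      by (intro vanishes_smult vanishes_monom) (auto intro: vanishes_coeff_le_1)
  qed
qed

lemma exact_order_pcompose_monom:
  assumes "exact_order k P" and q: "0 < q"
  shows "exact_order (k * q) (P \<circ>\<^sub>p monom 1 q)"
proof -
  define c where "c = coeff P k"
  have c: "av c = 1" and P: "vanishes k P"
    using assms by (simp_all add: exact_order_def c_def)
  have "vanishes (Suc k) (P - monom c k)"
    using P c by (auto simp: vanishes_def c_def less_Suc_eq)
  from vanishes_mono[OF vanishes_pcompose_monom[OF this, of q], of "Suc (k * q)"]
  have "vanishes (Suc (k * q)) (P \<circ>\<^sub>p monom 1 q - monom c (k * q))"
    using q by (simp add: pcompose_diff pcompose_monom monom_power smult_monom mult.commute)
  moreover have "exact_order (k * q) (monom c (k * q))"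
    using c by (simp add: exact_order_def vanishes_monom)
  ultimately show ?thesis
    using exact_order_cong by blast
qed

text \<open>Factor \<open>F^q - x^q\<close> as \<open>(F - x) S\<close>. The cofactor
  \<open>S\<close> is close to \<open>q x^(q-1)\<close>, and the product has order
  \<open>(e + 1) q = (q e + 1) + (q - 1)\<close>.\<close>

lemma exact_order_root:
  assumes F: "vanishes 2 (F - [:0, 1:])" and FH: "F ^ q = H \<circ>\<^sub>p monom 1 q"
    and H: "exact_order (e + 1) (H - [:0, 1:])" and q: "0 < q" "av (of_nat q) = 1"
  shows "exact_order (q * e + 1) (F - [:0, 1:])"
proof -
  define S where "S = (\<Sum>i<q. [:0, 1:] ^ (q - Suc i) * F ^ i)"
  have X: "[:0, 1:] ^ q = (monom 1 q :: 'a poly)"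
    by (simp add: monom_altdef)
  have "(F - [:0, 1:]) * S = F ^ q - [:0, 1:] ^ q"
    unfolding S_def by (rule power_diff_sumr2[symmetric])
  also have "\<dots> = (H - [:0, 1:]) \<circ>\<^sub>p monom 1 q"
    by (simp add: FH X pcompose_diff)
  finally have FS: "(F - [:0, 1:]) * S = (H - [:0, 1:]) \<circ>\<^sub>p monom 1 q" .
  have "(e + 1) * q = (q * e + 1) + (q - 1)"
    using q(1) by (cases q) simp_all
  then have "exact_order ((q * e + 1) + (q - 1)) ((F - [:0, 1:]) * S)"
    unfolding FS using exact_order_pcompose_monom[OF H q(1)] by (simp only:)
  moreover have "exact_order (q - 1) S"
  proof -
    have "monom (of_nat q) (q - 1) = (\<Sum>i<q. [:0, 1:] ^ (q - Suc i) * ([:0, 1:] ^ i :: 'a poly))"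
    proof -
      have "(\<Sum>i<q. [:0, 1:] ^ (q - Suc i) * ([:0, 1:] ^ i :: 'a poly)) = (\<Sum>i<q. monom 1 (q - 1))"
        by (intro sum.cong) (simp_all add: monom_altdef flip: power_add)
      then show ?thesis
        by (simp add: of_nat_poly monom_altdef)
    qed
    then have "S - monom (of_nat q) (q - 1) = (\<Sum>i<q. [:0, 1:] ^ (q - Suc i) * (F ^ i - [:0, 1:] ^ i))"
      by (simp only: S_def right_diff_distrib sum_subtractf)
    also have "vanishes q \<dots>"
    proof (rule vanishes_sum)
      fix i assume "i \<in> {..<q}"
      then have "q = (q - Suc i) + (i + 1)"
        by simp
      moreover have "vanishes ((q - Suc i) + (i + 1)) ([:0, 1:] ^ (q - Suc i) * (F ^ i - [:0, 1:] ^ i))"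
        using F vanishes_power[OF vanishes_X, of "q - Suc i"]
        by (intro vanishes_mult vanishes_power_diff) (simp_all add: numeral_2_eq_2)
      ultimately show "vanishes q ([:0, 1:] ^ (q - Suc i) * (F ^ i - [:0, 1:] ^ i))"
        by metis
    qed
    finally have "vanishes (Suc (q - 1)) (S - monom (of_nat q) (q - 1))"
      using q by simp
    moreover have "exact_order (q - 1) (monom (of_nat q) (q - 1))"
      using q by (simp add: exact_order_def vanishes_monom)
    ultimately show ?thesis
      using exact_order_cong by blast
  qed
  moreover have "integral_poly (F - [:0, 1:])"
    using F by (rule vanishes_imp_integral)
  ultimately show ?thesis
    using exact_order_cancel by blast
qed

text \<open>The order is found for the \<open>p^n\<close>-th iterate of the quotient map, is
  unchanged by the further \<open>q\<close>-th iterate because \<open>q\<close> is a unit, and is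
  pulled back by \<open>exact_order_root\<close>. Up to powers of \<open>lam ^ q\<close>, which
  reduces to 1, \<open>q\<close> and \<open>B\<close> are the coefficients of the quotient map in
  degrees 2 and 3.\<close>

lemma exact_order_cycle_poly:
  assumes p: "prime p" and residue: "av (of_nat p) < 1"
    and q: "0 < q" "\<not> p dvd q" and lam: "av lam = 1" "av (lam ^ q - 1) < 1" and b: "av b \<le> 1"
  defines "B \<equiv> of_nat q * b + of_nat (q choose 2)"
  assumes unit: "av (B - (of_nat q)\<^sup>2) = 1" "p = 2 \<Longrightarrow> av B = 1"
  shows "exact_order (q * (\<Sum>i\<le>n. p ^ i) + 1)
           (iter_poly (cycle_poly lam b q) (q * p ^ n) - [:0, 1:])"
proof -
  define f g L where "f = cycle_poly lam b q" and "g = cycle_poly_quotient lam b q" and "L = lam ^ q"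
  define e where "e = (\<Sum>i\<le>n. p ^ i)"
  have av_q: "av (of_nat q) = 1"
    by (rule av_of_nat_eq_1[OF residue p q(2)])
  have L: "av L = 1" "av (L - 1) < 1"
    using lam by (simp_all add: L_def av_power)
  have "g = pCons 0 (smult L ([:1, 1, b:] ^ q))"
    by (simp add: g_def L_def cycle_poly_quotient_def monom_altdef)
  then have g0: "coeff g 0 = 0" and g1: "coeff g 1 = L" and g2: "coeff g 2 = L * of_nat q"
    and g3: "coeff g 3 = L * B"
    using coeff_quadratic_power[of b q] by (simp_all add: B_def numeral_2_eq_2 numeral_3_eq_3)
  have g_int: "integral_poly g"
    unfolding g_def cycle_poly_quotient_def using lam b
    by (intro integral_mult integral_power vanishes_monom)
       (auto simp: av_power vanishes_def coeff_pCons split: nat.splits)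
  have "exact_order 2 (g - [:0, 1:])"
    using vanishes_diff[OF g_int integral_X] g0 g1 g2 L av_q
    by (auto simp: exact_order_def vanishes_def numeral_2_eq_2 less_Suc_eq av_mult)
  moreover have "av (coeff g 3 - (coeff g 2)\<^sup>2) = 1"
  proof -
    have B: "av B \<le> 1"
      unfolding B_def using b by (intro av_add_le_1 av_mult_le_1) auto
    have "(coeff g 3 - (coeff g 2)\<^sup>2) - (B - (of_nat q)\<^sup>2) = (L - 1) * (B - (L + 1) * (of_nat q)\<^sup>2)"
      unfolding g2 g3 by (simp add: power2_eq_square algebra_simps)
    moreover have "av ((L - 1) * (B - (L + 1) * (of_nat q)\<^sup>2)) < 1"
      using L B av_q
      by (intro av_mult_less_1 av_diff_le_1 av_mult_le_1 av_add_le_1 av_power_le_1) auto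
    ultimately show ?thesis
      using unit(1) av_eq_1_cong by metis
  qed
  moreover have "av (coeff g 3) = 1" if "p = 2"
    using unit(2)[OF that] L by (simp add: g3 av_mult)
  ultimately have G: "exact_order (e + 1) (iter_poly g (p ^ n) - [:0, 1:])"
    unfolding e_def by (rule exact_order_iterate_prime_power[OF p residue])
  have e: "1 \<le> e"
    unfolding e_def by (simp add: sum.atMost_shift)
  have "exact_order (e + 1) (iter_poly g (q * p ^ n) - [:0, 1:])"
    using exact_order_iterate_coprime[OF G e av_q] by (simp add: iter_poly_mult mult.commute)
  moreover have "vanishes 2 (iter_poly f (q * p ^ n) - [:0, 1:])"
  proof -
    have "av (L ^ m - 1) < 1" for m
    proof (induction m)
      case (Suc m)
      have "L ^ Suc m - 1 = L * (L ^ m - 1) + (L - 1)"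
        by (simp add: algebra_simps)
      then show ?case
        using Suc L by (metis av_add_less_1 av_mult_less_1' order_refl)
    qed simp
    then have "av (lam ^ (q * p ^ n) - 1) < 1"
      by (simp add: L_def power_mult)
    moreover have "integral_poly (iter_poly f (q * p ^ n) - [:0, 1:])"
      unfolding f_def using lam b
      by (intro vanishes_diff integral_iter_poly integral_cycle_poly integral_X) auto
    ultimately show ?thesis
      using cycle_poly_coeff_0[OF q(1), of lam b] cycle_poly_coeff_1[OF q(1), of lam b]
      by (auto simp: vanishes_def numeral_2_eq_2 less_Suc_eq iter_poly_coeff_0 iter_poly_coeff_1 f_def)
  qed
  ultimately show ?thesis
    using exact_order_root[OF _ cycle_poly_semiconj _ q(1) av_q] unfolding e_def f_def g_def
    by blast
qed

end

section \<open>Extension of places\<close>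

definition is_subring :: "'a::field set \<Rightarrow> bool" where
  "is_subring B \<longleftrightarrow> 1 \<in> B \<and> (\<forall>x\<in>B. \<forall>y\<in>B. x - y \<in> B \<and> x * y \<in> B)"

lemma
  assumes "is_subring B"
  shows subring_1: "1 \<in> B" and subring_0: "0 \<in> B"
    and subring_diff: "x \<in> B \<Longrightarrow> y \<in> B \<Longrightarrow> x - y \<in> B"
    and subring_mult: "x \<in> B \<Longrightarrow> y \<in> B \<Longrightarrow> x * y \<in> B"
    and subring_minus: "x \<in> B \<Longrightarrow> - x \<in> B"
    and subring_add: "x \<in> B \<Longrightarrow> y \<in> B \<Longrightarrow> x + y \<in> B"
    and subring_power: "x \<in> B \<Longrightarrow> x ^ n \<in> B"
proof -
  show 1: "1 \<in> B" and diff: "x \<in> B \<Longrightarrow> y \<in> B \<Longrightarrow> x - y \<in> B"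
    and mult: "x \<in> B \<Longrightarrow> y \<in> B \<Longrightarrow> x * y \<in> B" for x y
    using assms by (auto simp: is_subring_def)
  show 0: "0 \<in> B"
    using diff[OF 1 1] by simp
  show minus: "x \<in> B \<Longrightarrow> - x \<in> B" for x
    using diff[OF 0, of x] by simp
  show "x \<in> B \<Longrightarrow> y \<in> B \<Longrightarrow> x + y \<in> B"
    using diff[OF _ minus, of x y] by simp
  show "x \<in> B \<Longrightarrow> x ^ n \<in> B"
    using 1 mult by (induction n) auto
qed

lemma subring_sum: "is_subring B \<Longrightarrow> (\<And>i. i \<in> A \<Longrightarrow> f i \<in> B) \<Longrightarrow> sum f A \<in> B"
  by (induction A rule: infinite_finite_induct) (auto intro: subring_0 subring_add)

lemma subring_of_nat: "is_subring B \<Longrightarrow> of_nat n \<in> B"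
  by (induction n) (auto intro: subring_0 subring_add subring_1)

lemma subring_numeral: "is_subring B \<Longrightarrow> numeral n \<in> B"
  using subring_of_nat[of B "numeral n"] by simp

definition coeffs_in :: "'a::field set \<Rightarrow> 'a poly \<Rightarrow> bool" where
  "coeffs_in B P \<longleftrightarrow> (\<forall>i. coeff P i \<in> B)"

context
  fixes B :: "'a::field set"
  assumes B: "is_subring B"
begin

lemma coeffs_in_diff: "coeffs_in B P \<Longrightarrow> coeffs_in B Q \<Longrightarrow> coeffs_in B (P - Q)"
  by (auto simp: coeffs_in_def intro: subring_diff[OF B])

lemma coeffs_in_add: "coeffs_in B P \<Longrightarrow> coeffs_in B Q \<Longrightarrow> coeffs_in B (P + Q)"
  by (auto simp: coeffs_in_def intro: subring_add[OF B])

lemma coeffs_in_mult: "coeffs_in B P \<Longrightarrow> coeffs_in B Q \<Longrightarrow> coeffs_in B (P * Q)"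
  by (auto simp: coeffs_in_def coeff_mult intro!: subring_sum[OF B] subring_mult[OF B])

lemma coeffs_in_monom: "c \<in> B \<Longrightarrow> coeffs_in B (monom c n)"
  by (auto simp: coeffs_in_def subring_0[OF B])

lemma coeffs_in_smult: "c \<in> B \<Longrightarrow> coeffs_in B P \<Longrightarrow> coeffs_in B (smult c P)"
  by (auto simp: coeffs_in_def intro: subring_mult[OF B])

lemma coeffs_in_reflect: "coeffs_in B P \<Longrightarrow> coeffs_in B (reflect_poly P)"
  by (auto simp: coeffs_in_def coeff_reflect_poly subring_0[OF B])

lemma subring_adjoin:
  "is_subring {y. \<exists>P. coeffs_in B P \<and> y = poly P x}" (is "is_subring ?C")
  and subring_le_adjoin: "B \<subseteq> {y. \<exists>P. coeffs_in B P \<and> y = poly P x}"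
  and mem_adjoin: "x \<in> {y. \<exists>P. coeffs_in B P \<and> y = poly P x}"
proof -
  show *: "B \<subseteq> ?C"
  proof
    fix c assume "c \<in> B"
    then have "coeffs_in B (monom c 0) \<and> c = poly (monom c 0) x"
      by (simp add: coeffs_in_monom poly_monom)
    then show "c \<in> ?C"
      by blast
  qed
  have "coeffs_in B (monom 1 1) \<and> x = poly (monom 1 1) x"
    by (simp add: coeffs_in_monom subring_1[OF B] poly_monom)
  then show "x \<in> ?C"
    by blast
  have "y - z \<in> ?C \<and> y * z \<in> ?C" if "y \<in> ?C" "z \<in> ?C" for y z
  proof -
    obtain P Q where "coeffs_in B P" "y = poly P x" "coeffs_in B Q" "z = poly Q x"
      using \<open>y \<in> ?C\<close> \<open>z \<in> ?C\<close> by blast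
    then have "coeffs_in B (P - Q) \<and> y - z = poly (P - Q) x"
      and "coeffs_in B (P * Q) \<and> y * z = poly (P * Q) x"
      by (simp_all add: coeffs_in_diff coeffs_in_mult)
    then show ?thesis
      by blast
  qed
  moreover have "1 \<in> ?C"
    using * subring_1[OF B] by (rule subsetD)
  ultimately show "is_subring ?C"
    unfolding is_subring_def by blast
qed

end

text \<open>A subring that is maximal among those avoiding \<open>l\<close> but containing \<open>1 / l\<close> is a valuation ring.\<close>

theorem chevalley_extension:
  fixes A :: "'a::field set"
  assumes A: "is_subring A" and l: "l \<notin> A" "inverse l \<in> A"
  obtains B where "is_subring B" "A \<subseteq> B" "l \<notin> B" "\<And>x. x \<in> B \<or> inverse x \<in> B"
proof -
  define S where "S = {B. is_subring B \<and> A \<subseteq> B \<and> l \<notin> B}"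
  have "\<exists>M\<in>S. \<forall>X\<in>S. M \<subseteq> X \<longrightarrow> X = M"
  proof (rule subset_Zorn_nonempty)
    show "S \<noteq> {}"
      using A l by (auto simp: S_def)
  next
    fix \<C> assume ne: "\<C> \<noteq> {}" and ch: "subset.chain S \<C>"
    have sub: "X \<in> S" if "X \<in> \<C>" for X
      using ch that by (auto simp: subset_chain_def)
    have "x - y \<in> \<Union>\<C> \<and> x * y \<in> \<Union>\<C>" if xy: "x \<in> \<Union>\<C>" "y \<in> \<Union>\<C>" for x y
    proof -
      obtain X Y where XY: "X \<in> \<C>" "Y \<in> \<C>" "x \<in> X" "y \<in> Y"
        using xy by blast
      then have "X \<subseteq> Y \<or> Y \<subseteq> X"
        using ch by (auto simp: subset_chain_def)
      then obtain Z where Z: "Z \<in> \<C>" "x \<in> Z" "y \<in> Z"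
        using XY by blast
      from sub[OF Z(1)] have "is_subring Z"
        by (simp add: S_def)
      then show ?thesis
        using Z by (auto simp: is_subring_def)
    qed
    moreover have "1 \<in> \<Union>\<C>" "A \<subseteq> \<Union>\<C>" "l \<notin> \<Union>\<C>"
      using ne sub by (auto simp: S_def is_subring_def)
    ultimately show "\<Union>\<C> \<in> S"
      by (simp add: S_def is_subring_def)
  qed
  then obtain B where "B \<in> S" and max: "\<And>X. X \<in> S \<Longrightarrow> B \<subseteq> X \<Longrightarrow> X = B"
    by blast
  then have B: "is_subring B" and AB: "A \<subseteq> B" and lB: "l \<notin> B"
    by (auto simp: S_def)
  define u where "u = inverse l"
  have l0: "l \<noteq> 0"
    using lB subring_0[OF B] by auto
  have u: "u \<in> B" "u * l = 1"
    using l AB l0 by (auto simp: u_def)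
  \<comment> \<open>Otherwise adjoining \<open>x\<close> would give a larger ring that still avoids
    \<open>l\<close>.\<close>
  have adjoin: "\<exists>P. coeffs_in B P \<and> l = poly P x" if "x \<notin> B" for x
  proof (rule ccontr)
    assume *: "\<nexists>P. coeffs_in B P \<and> l = poly P x"
    have "{y. \<exists>P. coeffs_in B P \<and> y = poly P x} = B"
    proof (rule max)
      show "{y. \<exists>P. coeffs_in B P \<and> y = poly P x} \<in> S"
        using * subring_adjoin[OF B, of x] subring_le_adjoin[OF B, of x] AB by (auto simp: S_def)
    qed (rule subring_le_adjoin[OF B])
    then show False
      using mem_adjoin[OF B, of x] that by blast
  qed
  \<comment> \<open>So \<open>u\<close> lies in the Jacobson radical. If \<open>1 / y\<close> were
    missing, \<open>l\<close> would be a polynomial in \<open>1 / y\<close>; multiplying by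
    \<open>y^degree P = 1 - u c'\<close> and using \<open>u l = 1\<close> puts
    \<open>l - c'\<close>, hence \<open>l\<close>, into \<open>B\<close>.\<close>
  have inv: "inverse (1 - u * c) \<in> B" and nz: "1 - u * c \<noteq> 0" if c: "c \<in> B" for c
  proof -
    define y where "y = 1 - u * c"
    show nz: "1 - u * c \<noteq> 0"
    proof
      assume "1 - u * c = 0"
      then have "l = c"
        using u(2) l0 by (simp add: u_def field_simps)
      then show False
        using c lB by simp
    qed
    have y: "y \<in> B"
      unfolding y_def by (intro subring_diff[OF B] subring_mult[OF B] subring_1[OF B] u c)
    have pw: "\<exists>c'\<in>B. y ^ k = 1 - u * c'" for k
    proof (induction k)
      case 0
      then show ?case
        using subring_0[OF B] by (intro bexI[of _ 0]) auto
    next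
      case (Suc k)
      then obtain c' where c': "c' \<in> B" "y ^ k = 1 - u * c'" ..
      have "y ^ Suc k = 1 - u * (c + c' - u * c * c')"
        unfolding power_Suc c'(2) by (simp add: y_def algebra_simps)
      moreover have "c + c' - u * c * c' \<in> B"
        by (intro subring_diff[OF B] subring_add[OF B] subring_mult[OF B] u c c')
      ultimately show ?case
        by blast
    qed
    have "inverse y \<in> B"
    proof (rule ccontr)
      assume "inverse y \<notin> B"
      then obtain P where P: "coeffs_in B P" "l = poly P (inverse y)"
        using adjoin by blast
      obtain c' where c': "c' \<in> B" "y ^ degree P = 1 - u * c'"
        using pw by blast
      have "poly (reflect_poly P) y = y ^ degree P * l"
        using nz by (simp add: y_def poly_reflect_poly_nz P(2))
      also have "\<dots> = l - c'"
        using u(2) by (simp add: c' algebra_simps)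
      finally have "l = poly (reflect_poly P) y + c'"
        by simp
      moreover have "poly (reflect_poly P) y \<in> B"
        unfolding poly_altdef using coeffs_in_reflect[OF B P(1)]
        by (intro subring_sum[OF B] subring_mult[OF B] subring_power[OF B] y) (auto simp: coeffs_in_def)
      ultimately show False
        using lB c' subring_add[OF B] by metis
    qed
    then show "inverse (1 - u * c) \<in> B"
      by (simp add: y_def)
  qed
  have deg_pos: "0 < degree P" if "coeffs_in B P" "l = poly P x" for P x
  proof (rule ccontr)
    assume "\<not> 0 < degree P"
    then obtain c where "P = [:c:]"
      by (auto elim: degree_eq_zeroE)
    then show False
      using that lB by (auto simp: coeffs_in_def dest: spec[of _ 0])
  qed
  \<comment> \<open>Multiply the representation of \<open>l\<close> in \<open>1 / x\<close> by
    \<open>u x^(m + 1)\<close>. As \<open>1 - u a\<close> is invertible, this expresses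
    \<open>x^(m + 1)\<close> through lower powers of \<open>x\<close> over \<open>B\<close>, and the
    leading term of \<open>P\<close> can be replaced.\<close>
  have reduce: "\<exists>P'. coeffs_in B P' \<and> l = poly P' x \<and> degree P' < degree P"
    if x: "x \<noteq> 0" and P: "coeffs_in B P" "l = poly P x"
      and Q: "coeffs_in B Q" "l = poly Q (inverse x)" and le: "degree Q \<le> degree P" for x P Q
  proof -
    obtain a Q' where Qa: "Q = pCons a Q'"
      by (rule pCons_cases)
    define n m where "n = degree P" and "m = degree Q'"
    have Q'0: "Q' \<noteq> 0" and n: "m < n"
      using deg_pos[OF Q] le by (auto simp: Qa n_def m_def split: if_splits)
    have a: "a \<in> B" and Q'B: "coeffs_in B Q'"
      using Q(1) unfolding Qa coeffs_in_def by (metis coeff_pCons_0, metis coeff_pCons_Suc)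
    define v where "v = inverse (1 - u * a) * u"
    have v: "v \<in> B"
      unfolding v_def by (intro subring_mult[OF B] inv a u)
    define R where "R = reflect_poly Q'"
    have "l * x ^ Suc m = a * x ^ Suc m + poly R x"
      using x by (subst Q(2)) (simp add: Qa R_def poly_reflect_poly_nz m_def field_simps)
    then have "u * l * x ^ Suc m = u * (a * x ^ Suc m + poly R x)"
      by (simp only: mult.assoc)
    then have "(1 - u * a) * x ^ Suc m = u * poly R x"
      unfolding u(2) by (simp add: algebra_simps)
    then have xm: "x ^ Suc m = v * poly R x"
      using nz[OF a] by (simp add: v_def field_simps)
    define P' where "P' = P - monom (coeff P n) n + smult (coeff P n * v) (monom 1 (n - Suc m) * R)"
    have "x ^ n = x ^ (n - Suc m) * x ^ Suc m"
      using n by (simp flip: power_add power_Suc)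
    then have "poly P' x = poly P x"
      unfolding xm by (simp add: P'_def poly_monom)
    moreover have "coeffs_in B P'"
      unfolding P'_def R_def using P(1) v
      by (intro coeffs_in_add[OF B] coeffs_in_diff[OF B] coeffs_in_monom[OF B] coeffs_in_smult[OF B]
          coeffs_in_mult[OF B] coeffs_in_reflect[OF B] Q'B subring_mult[OF B] subring_1[OF B])
         (auto simp: coeffs_in_def)
    moreover have "degree P' < n"
    proof -
      have "degree (P - monom (coeff P n) n) \<le> n - 1"
      proof (rule degree_le, intro allI impI)
        fix i assume "n - 1 < i"
        then show "coeff (P - monom (coeff P n) n) i = 0"
          using n by (cases "i = n") (auto simp: n_def intro: coeff_eq_0)
      qed
      moreover have "degree (smult (coeff P n * v) (monom 1 (n - Suc m) * R)) \<le> n - 1"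
      proof -
        have "degree (monom 1 (n - Suc m) * R) \<le> (n - Suc m) + m"
          using degree_mult_le[of "monom 1 (n - Suc m)" R] degree_monom_le[of "1::'a" "n - Suc m"]
            degree_reflect_poly_le[of Q'] by (simp add: R_def m_def)
        then show ?thesis
          using n degree_smult_le[of "coeff P n * v" "monom 1 (n - Suc m) * R"] by linarith
      qed
      ultimately have "degree P' \<le> n - 1"
        unfolding P'_def by (rule degree_add_le)
      with n show ?thesis
        by simp
    qed
    ultimately show ?thesis
      using P(2) n_def by auto
  qed
  have val: "x \<in> B \<or> inverse x \<in> B" for x
  proof (rule ccontr)
    assume *: "\<not> (x \<in> B \<or> inverse x \<in> B)"
    then have x: "x \<noteq> 0"
      using subring_0[OF B] by auto
    \<comment> \<open>With representations of least degree in \<open>x\<close> and in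
      \<open>1 / x\<close>, \<open>reduce\<close> would shorten the longer one.\<close>
    have least: "\<exists>P. (coeffs_in B P \<and> l = poly P y) \<and>
        (\<forall>P'. coeffs_in B P' \<and> l = poly P' y \<longrightarrow> degree P \<le> degree P')" if y: "y \<notin> B" for y
    proof -
      obtain P where "coeffs_in B P \<and> l = poly P y"
        using adjoin[OF y] ..
      then show ?thesis
        by (rule ex_has_least_nat)
    qed
    have "x \<notin> B" "inverse x \<notin> B"
      using * by simp_all
    with least[of x] least[of "inverse x"] obtain P Q where P: "coeffs_in B P" "l = poly P x"
        "\<And>P'. coeffs_in B P' \<Longrightarrow> l = poly P' x \<Longrightarrow> degree P \<le> degree P'"
      and Q: "coeffs_in B Q" "l = poly Q (inverse x)"
        "\<And>Q'. coeffs_in B Q' \<Longrightarrow> l = poly Q' (inverse x) \<Longrightarrow> degree Q \<le> degree Q'"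
      by blast
    show False
    proof (cases "degree Q \<le> degree P")
      case True
      then show False
        using reduce[OF x P(1,2) Q(1,2)] P(3) by (meson not_le)
    next
      case False
      then show False
        using reduce[of "inverse x" Q P] x P(1,2) Q by (metis inverse_inverse_eq inverse_nonzero_iff_nonzero linear not_le)
    qed
  qed
  show ?thesis
    by (rule that[OF B AB lB val])
qed

section \<open>Multipliers of periodic points at the place at infinity\<close>

locale place =
  fixes B :: "'a::field set"
  assumes B: "is_subring B" and valuation: "\<And>x. x \<in> B \<or> inverse x \<in> B"
begin

text \<open>The non-units of \<open>B\<close>. Zero needs its own disjunct because
  \<open>inverse 0 = 0\<close> belongs to \<open>B\<close>.\<close>

definition M :: "'a set" where
  "M = {x \<in> B. x = 0 \<or> inverse x \<notin> B}"

lemma M_subset: "x \<in> M \<Longrightarrow> x \<in> B"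
  by (simp add: M_def)

lemma zero_in_M: "0 \<in> M"
  using subring_0[OF B] by (simp add: M_def)

lemma one_not_in_M: "1 \<notin> M"
  using subring_1[OF B] by (simp add: M_def)

lemma M_mult: "x \<in> M \<Longrightarrow> y \<in> B \<Longrightarrow> x * y \<in> M"
proof -
  assume x: "x \<in> M" and y: "y \<in> B"
  have "inverse (x * y) \<notin> B" if nz: "x * y \<noteq> 0"
  proof
    assume "inverse (x * y) \<in> B"
    then have "y * inverse (x * y) \<in> B"
      using y by (rule subring_mult[OF B, rotated])
    moreover have "y * inverse (x * y) = inverse x"
      using nz by (simp add: field_simps)
    ultimately have "inverse x \<in> B"
      by (simp only:)
    then show False
      using x nz by (auto simp: M_def)
  qed
  then show "x * y \<in> M"
    using subring_mult[OF B M_subset[OF x] y] unfolding M_def by blast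
qed

lemma M_add: "x \<in> M \<Longrightarrow> y \<in> M \<Longrightarrow> x + y \<in> M"
proof -
  have main: "x + y \<in> M" if "x \<in> M" "y \<noteq> 0" "y \<in> M" "x / y \<in> B" for x y
  proof -
    have "x + y = y * (x / y + 1)"
      using that by (simp add: field_simps)
    moreover have "x / y + 1 \<in> B"
      by (intro subring_add[OF B] subring_1[OF B] that)
    ultimately show ?thesis
      using M_mult[OF that(3)] by metis
  qed
  assume xy: "x \<in> M" "y \<in> M"
  show "x + y \<in> M"
  proof (cases "x = 0 \<or> y = 0")
    case False
    then have "inverse (x / y) = y / x"
      by simp
    then have "x / y \<in> B \<or> y / x \<in> B"
      using valuation[of "x / y"] by simp
    then show ?thesis
      using main[of x y] main[of y x] xy False by (auto simp: add.commute)
  qed (use xy in auto)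
qed

lemma M_minus: "x \<in> M \<Longrightarrow> - x \<in> M"
  using M_mult[of x "- 1"] subring_minus[OF B subring_1[OF B]] by simp

lemma inverse_in_M: "x \<notin> B \<Longrightarrow> inverse x \<in> M"
  using valuation[of x] by (auto simp: M_def)

lemma inverse_in_B: "x \<in> B \<Longrightarrow> x \<notin> M \<Longrightarrow> inverse x \<in> B"
  by (simp add: M_def)

lemma not_in_M_if_inverse: "x \<noteq> 0 \<Longrightarrow> inverse x \<in> B \<Longrightarrow> x \<notin> M"
  by (simp add: M_def)

lemma M_mult_not_in:
  assumes "x \<in> B" "x \<notin> M" "y \<in> B" "y \<notin> M"
  shows "x * y \<notin> M"
proof
  assume xy: "x * y \<in> M"
  have "x \<noteq> 0"
    using assms(2) zero_in_M by auto
  then have "y = x * y * inverse x"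
    by simp
  then have "y \<in> M"
    using M_mult[OF xy inverse_in_B[OF assms(1,2)]] by metis
  with assms(4) show False ..
qed

lemma M_power_not_in: "x \<in> B \<Longrightarrow> x \<notin> M \<Longrightarrow> x ^ n \<notin> M"
  using M_mult_not_in[OF _ _ subring_power[OF B]] by (induction n) (auto simp: one_not_in_M)

lemma M_power: "x \<in> M \<Longrightarrow> 0 < n \<Longrightarrow> x ^ n \<in> M"
  by (cases n) (auto intro: M_mult subring_power[OF B] M_subset)

lemma add_M_not_in:
  assumes "x \<notin> M" "y \<in> M"
  shows "x + y \<notin> M"
proof
  assume "x + y \<in> M"
  from M_add[OF this M_minus[OF assms(2)]] assms(1) show False
    by simp
qed

end

text \<open>\<open>b\<close> governs the behaviour at infinity, \<open>1 - 4 b\<close> is the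
  discriminant of \<open>1 + w + b w^2\<close>, and \<open>q\<close> is the factor produced by
  differentiating \<open>w = x^q\<close>.\<close>

locale place_cycle_poly = place B for B :: "'a::field set" +
  fixes lam b :: 'a and q :: nat
  assumes lam: "lam \<notin> B" and q: "0 < q"
    and units: "b \<in> B" "b \<notin> M" "1 - 4 * b \<notin> M" "of_nat q \<notin> M"
begin

lemma poly_cycle_poly: "poly (cycle_poly lam b q) x = lam * x * (1 + x ^ q + b * (x ^ q)\<^sup>2)"
  by (simp add: cycle_poly_def poly_monom power_even_eq)

lemma poly_pderiv_cycle_poly:
  "poly (pderiv (cycle_poly lam b q)) x
     = lam * (1 + x ^ q + b * (x ^ q)\<^sup>2 + of_nat q * (x ^ q * (1 + 2 * b * x ^ q)))"
proof -
  have eq: "cycle_poly lam b q = monom lam 1 + monom lam (q + 1) + monom (lam * b) (2 * q + 1)"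
    by (simp add: cycle_poly_def distrib_left mult_monom monom_altdef mult.commute)
  show ?thesis
    unfolding eq by (simp add: pderiv_add pderiv_monom poly_monom power_even_eq) (simp add: algebra_simps power2_eq_square)
qed

lemma inverse_lam: "inverse lam \<in> M"
  using lam by (rule inverse_in_M)

lemma lam_nonzero: "lam \<noteq> 0"
  using lam subring_0[OF B] by auto

text \<open>Outside \<open>B\<close> the top term dominates since \<open>b\<close> is a unit, and
  \<open>lam\<close> is infinite; so \<open>1 / x\<close> shrinks strictly and the orbit cannot
  return.\<close>

lemma escape:
  assumes x: "x \<notin> B"
  shows "poly (cycle_poly lam b q) x \<notin> B"
    and "\<exists>m\<in>M. inverse (poly (cycle_poly lam b q) x) = inverse x * m"
proof -
  define y where "y = inverse x"
  define w where "w = b + (y ^ q + (y ^ q)\<^sup>2)"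
  define m where "m = inverse lam * ((y ^ q)\<^sup>2 * inverse w)"
  have x0: "x \<noteq> 0"
    using x subring_0[OF B] by auto
  have y: "y \<in> M"
    unfolding y_def using x by (rule inverse_in_M)
  have yq: "y ^ q \<in> M"
    using y q by (rule M_power)
  have w: "w \<notin> M"
    unfolding w_def by (rule add_M_not_in[OF units(2) M_add[OF yq M_power[OF yq]]]) simp
  have wB: "w \<in> B"
    unfolding w_def using yq by (intro subring_add[OF B] subring_power[OF B, of "y ^ q"] units M_subset)
  have m: "m \<in> M"
    unfolding m_def using yq
    by (intro M_mult[OF inverse_lam] subring_mult[OF B] subring_power[OF B, of "y ^ q"]
        inverse_in_B[OF wB w]) (auto intro: M_subset)
  have w0: "w \<noteq> 0"
    using w zero_in_M by auto
  have "w = (y ^ q)\<^sup>2 * (1 + x ^ q + b * (x ^ q)\<^sup>2)"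
    using x0 by (simp add: w_def y_def field_simps power2_eq_square)
  then have eq: "inverse (poly (cycle_poly lam b q) x) = inverse x * m"
    using x0 w0 lam_nonzero by (simp add: poly_cycle_poly m_def y_def field_simps)
  then show "\<exists>m\<in>M. inverse (poly (cycle_poly lam b q) x) = inverse x * m"
    using m by blast
  have "inverse (poly (cycle_poly lam b q) x) \<in> M"
    unfolding eq using M_mult[OF y M_subset[OF m]] by (simp add: y_def)
  moreover have "inverse x * m \<noteq> 0"
    using x0 w0 lam_nonzero by (simp add: m_def y_def)
  ultimately show "poly (cycle_poly lam b q) x \<notin> B"
    unfolding eq[symmetric] by (auto simp: M_def)
qed

lemma periodic_in_B:
  assumes per: "(poly (cycle_poly lam b q) ^^ L) x = x" and L: "0 < L"
  shows "x \<in> B"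
proof (rule ccontr)
  assume x: "x \<notin> B"
  let ?f = "poly (cycle_poly lam b q)"
  have "(?f ^^ k) x \<notin> B \<and> (0 < k \<longrightarrow> (\<exists>m\<in>M. inverse ((?f ^^ k) x) = inverse x * m))" for k
  proof (induction k)
    case (Suc k)
    then obtain m where m: "m \<in> M" "inverse ((?f ^^ Suc k) x) = inverse ((?f ^^ k) x) * m"
      using escape(2) by (auto simp del: inverse_eq_iff_eq)
    have "\<exists>m\<in>M. inverse ((?f ^^ Suc k) x) = inverse x * m"
    proof (cases "k = 0")
      case True
      then show ?thesis
        using m by auto
    next
      case False
      with Suc obtain m' where m': "m' \<in> M" "inverse ((?f ^^ k) x) = inverse x * m'"
        by auto
      have "inverse ((?f ^^ Suc k) x) = inverse x * (m' * m)"
        unfolding m(2) m'(2) by (rule mult.assoc)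
      then show ?thesis
        using M_mult[OF m'(1) M_subset[OF m(1)]] by blast
    qed
    then show ?case
      using Suc escape(1) by auto
  qed (use x in auto)
  then obtain m where m: "m \<in> M" "inverse x = inverse x * m"
    using per L by metis
  moreover have "x \<noteq> 0"
    using x subring_0[OF B] by auto
  ultimately show False
    using one_not_in_M by auto
qed

text \<open>At a point \<open>x\<close> with integral image the reduction of \<open>x (1 + w + b w\<^sup>2)\<close>, \<open>w = x ^ q\<close>, vanishes;
  its roots are simple because of \<open>(1 + 2 b w)\<^sup>2 = 1 - 4 b + 4 b (1 + w + b w\<^sup>2)\<close>.\<close>

lemma derivative_unit:
  assumes x: "x \<in> B" and fx: "poly (cycle_poly lam b q) x \<in> B"
  shows "\<exists>\<eta>\<in>B - M. poly (pderiv (cycle_poly lam b q)) x = lam * \<eta>"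
proof -
  define w where "w = x ^ q"
  define k where "k = 1 + w + b * w\<^sup>2"
  define \<eta> where "\<eta> = k + of_nat q * (w * (1 + 2 * b * w))"
  have w: "w \<in> B"
    unfolding w_def using x by (rule subring_power[OF B])
  have k: "k \<in> B"
    unfolding k_def
    by (intro subring_add[OF B] subring_mult[OF B] subring_1[OF B] subring_power[OF B] units w)
  have c: "1 + 2 * b * w \<in> B"
    by (intro subring_add[OF B] subring_mult[OF B] subring_1[OF B] subring_numeral[OF B] units w)
  have eta: "\<eta> \<in> B"
    unfolding \<eta>_def
    by (intro subring_add[OF B] subring_mult[OF B] subring_of_nat[OF B] k c w)
  have "x * k = inverse lam * poly (cycle_poly lam b q) x"
    using lam_nonzero by (simp add: poly_cycle_poly k_def w_def field_simps)
  then have xk: "x * k \<in> M"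
    using M_mult[OF inverse_lam fx] by simp
  have "\<eta> \<notin> M"
  \<comment> \<open>If \<open>x\<close> reduces to 0, \<eta> reduces to 1. Otherwise
    \<open>k\<close> must reduce to 0, and only \<open>q w (1 + 2 b w)\<close> remains of
    \<eta>.\<close>
  proof (cases "x \<in> M")
    case True
    then have wM: "w \<in> M"
      unfolding w_def using q by (rule M_power)
    have "\<eta> = 1 + w * (1 + b * w + of_nat q * (1 + 2 * b * w))"
      by (simp add: \<eta>_def k_def algebra_simps power2_eq_square)
    moreover have "1 + b * w + of_nat q * (1 + 2 * b * w) \<in> B"
      by (intro subring_add[OF B] subring_mult[OF B] subring_1[OF B] subring_of_nat[OF B] units w c)
    ultimately show ?thesis
      using add_M_not_in[OF one_not_in_M M_mult[OF wM]] by metis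
  next
    case False
    then have kM: "k \<in> M"
      using M_mult_not_in[OF x _ k] xk by blast
    have "(1 + 2 * b * w)\<^sup>2 = (1 - 4 * b) + k * (4 * b)"
      by (simp add: k_def algebra_simps power2_eq_square)
    moreover have "4 * b \<in> B"
      by (intro subring_mult[OF B] subring_numeral[OF B] units)
    ultimately have "(1 + 2 * b * w)\<^sup>2 \<notin> M"
      using add_M_not_in[OF units(3) M_mult[OF kM]] by metis
    then have "1 + 2 * b * w \<notin> M"
      using M_power[of "1 + 2 * b * w" 2] by auto
    moreover have "w \<notin> M"
      unfolding w_def using x False by (rule M_power_not_in)
    ultimately have "of_nat q * (w * (1 + 2 * b * w)) \<notin> M"
      using c w by (intro M_mult_not_in subring_mult[OF B] subring_of_nat[OF B] units)
    from add_M_not_in[OF this kM] show ?thesis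
      by (simp add: \<eta>_def add.commute)
  qed
  moreover have "poly (pderiv (cycle_poly lam b q)) x = lam * \<eta>"
    by (simp add: poly_pderiv_cycle_poly \<eta>_def k_def w_def)
  ultimately show ?thesis
    using eta by blast
qed

text \<open>By the chain rule along the orbit, which stays in \<open>B\<close>, the multiplier is
  \<open>lam^L\<close> times a unit. If a power of it were 1, a unit would equal a positive power of
  \<open>1 / lam\<close>.\<close>

theorem multiplier_not_root_of_unity:
  assumes L: "0 < L" and N: "0 < N" and per: "poly (iter_poly (cycle_poly lam b q) L) z = z"
  shows "poly (pderiv (iter_poly (cycle_poly lam b q) L)) z ^ N \<noteq> 1"
proof
  let ?f = "cycle_poly lam b q"
  have per': "(poly ?f ^^ L) z = z"
    using per by (simp add: poly_iter_poly)
  have orbit: "(poly ?f ^^ k) z \<in> B" for k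
  proof (rule periodic_in_B[OF _ L])
    show "(poly ?f ^^ L) ((poly ?f ^^ k) z) = (poly ?f ^^ k) z"
    proof -
      have "(poly ?f ^^ L) ((poly ?f ^^ k) z) = (poly ?f ^^ (k + L)) z"
        by (simp only: add.commute[of k] funpow_add o_apply)
      also have "\<dots> = (poly ?f ^^ k) z"
        by (simp only: funpow_add o_apply per')
      finally show ?thesis .
    qed
  qed
  have "\<exists>\<eta>\<in>B - M. poly (pderiv (iter_poly ?f k)) z = lam ^ k * \<eta>" for k
  proof (induction k)
    case 0
    then show ?case
      using subring_1[OF B] one_not_in_M by (intro bexI[of _ 1]) (auto simp: pderiv_pCons)
  next
    case (Suc k)
    then obtain \<eta> where \<eta>: "\<eta> \<in> B - M" "poly (pderiv (iter_poly ?f k)) z = lam ^ k * \<eta>" ..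
    have "poly ?f ((poly ?f ^^ k) z) \<in> B"
      using orbit[of "Suc k"] by simp
    from derivative_unit[OF orbit this] obtain \<eta>' where
      \<eta>': "\<eta>' \<in> B - M" "poly (pderiv ?f) ((poly ?f ^^ k) z) = lam * \<eta>'" ..
    have "poly (pderiv (iter_poly ?f (Suc k))) z = lam ^ Suc k * (\<eta>' * \<eta>)"
      by (simp add: iter_poly_Suc pderiv_pcompose poly_pcompose poly_iter_poly \<eta> \<eta>' mult_ac)
    moreover have "\<eta>' * \<eta> \<in> B - M"
      using \<eta> \<eta>' M_mult_not_in subring_mult[OF B] by blast
    ultimately show ?case
      by blast
  qed
  then obtain \<eta> where \<eta>: "\<eta> \<in> B" "\<eta> \<notin> M" "poly (pderiv (iter_poly ?f L)) z = lam ^ L * \<eta>"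
    by blast
  assume "poly (pderiv (iter_poly ?f L)) z ^ N = 1"
  then have "lam ^ (L * N) * \<eta> ^ N = 1"
    by (simp only: \<eta>(3) power_mult_distrib power_mult)
  then have "\<eta> ^ N = inverse lam ^ (L * N)"
    unfolding power_inverse by (rule inverse_unique[symmetric])
  moreover have "inverse lam ^ (L * N) \<in> M"
    using L N by (intro M_power inverse_lam) simp
  ultimately show False
    using M_power_not_in[OF \<eta>(1,2), of N] by simp
qed

end

section \<open>Transcendence over the prime ring\<close>

text \<open>One notion for both characteristics. In positive characteristic no element satisfies
  \<open>transcendental_prime\<close>, as a nonzero constant integer polynomial maps to 0; here the
  coefficients are taken in the field itself.\<close>

definition prime_ring_transcendental :: "'a::field \<Rightarrow> bool" where
  "prime_ring_transcendental x \<longleftrightarrow> (\<forall>Q. coeffs_in \<int> Q \<longrightarrow> poly Q x = 0 \<longrightarrow> Q = 0)"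

lemma is_subring_Ints: "is_subring \<int>"
  by (simp add: is_subring_def)

lemma transcendental_prime_imp:
  fixes x :: "'a::field"
  assumes x: "transcendental_prime x"
  shows "prime_ring_transcendental x"
  unfolding prime_ring_transcendental_def
proof (intro allI impI, rule ccontr)
  fix Q :: "'a poly"
  assume Q: "coeffs_in \<int> Q" "poly Q x = 0" "Q \<noteq> 0"
  \<comment> \<open>The value at 0 is forced for the sake of \<open>coeff_map_poly\<close>; the
    choice operator might pick a nonzero preimage of 0.\<close>
  define g :: "'a \<Rightarrow> int" where "g c = (if c = 0 then 0 else SOME n. of_int n = c)" for c
  have g: "of_int (g c) = c" if "c \<in> \<int>" for c
  proof -
    from that obtain n where "of_int n = c"
      by (auto elim: Ints_cases)
    then have "of_int (SOME n. of_int n = c) = c"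
      by (rule someI)
    then show ?thesis
      by (simp add: g_def)
  qed
  have Q': "map_poly of_int (map_poly g Q) = Q"
    using Q(1) by (intro poly_eqI) (simp add: coeff_map_poly g_def[of 0] g coeffs_in_def)
  with Q(3) have "map_poly g Q \<noteq> 0"
    by auto
  with x Q(2) Q' show False
    unfolding transcendental_prime_def by metis
qed

lemma Ints_power_CHAR:
  fixes c :: "'a::field"
  assumes "prime CHAR('a)" "c \<in> \<int>"
  shows "c ^ CHAR('a) = c"
proof -
  have nat: "(of_nat n :: 'a) ^ CHAR('a) = of_nat n" for n
    using assms(1) prime_gt_0_nat[OF assms(1)]
    by (induction n) (simp_all add: freshmans_dream)
  from assms(2) obtain m where "c = of_int m"
    by (auto elim: Ints_cases)
  then show ?thesis
    using nat minus_power_prime_CHAR[OF refl assms(1)] by (cases m rule: int_cases2) simp_all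
qed

text \<open>Frobenius fixes the coefficients, since they lie in the prime field.\<close>

lemma poly_power_CHAR:
  fixes x :: "'a::field"
  assumes "prime CHAR('a)" "coeffs_in \<int> Q"
  shows "poly Q (x ^ CHAR('a)) = poly Q x ^ CHAR('a)"
proof -
  have "coeff Q i ^ CHAR('a) = coeff Q i" for i
    using assms by (intro Ints_power_CHAR) (auto simp: coeffs_in_def)
  then show ?thesis
    using assms(1)
    by (simp add: poly_altdef freshmans_dream_sum power_mult_distrib mult.commute flip: power_mult)
qed

text \<open>In positive characteristic a root of \<open>Q\<close> has only finitely many iterates under Frobenius, whereas
  Frobenius strictly shrinks \<open>x ^ q - 1\<close>.\<close>

lemma (in ultrametric_field) prime_ring_transcendental_if_CHAR:
  assumes CHAR: "prime CHAR('a)" and x: "0 < av (x ^ q - 1)" "av (x ^ q - 1) < 1"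
  shows "prime_ring_transcendental x"
  unfolding prime_ring_transcendental_def
proof (intro allI impI, rule ccontr)
  fix Q :: "'a poly"
  assume Q: "coeffs_in \<int> Q" "poly Q x = 0" "Q \<noteq> 0"
  define r where "r = CHAR('a)"
  define \<epsilon> where "\<epsilon> = x ^ q - 1"
  have r: "prime r"
    using CHAR by (simp add: r_def)
  have root: "poly Q (x ^ r ^ k) = 0" for k
  proof (induction k)
    case (Suc k)
    have "poly Q (x ^ r ^ Suc k) = poly Q ((x ^ r ^ k) ^ r)"
      by (simp add: mult.commute flip: power_mult)
    then show ?case
      using Suc poly_power_CHAR[OF CHAR Q(1), of "x ^ r ^ k"] prime_gt_0_nat[OF r]
      by (simp add: r_def)
  qed (use Q in simp)
  have "finite (range (\<lambda>k. x ^ r ^ k))"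
    using root by (intro finite_subset[OF _ poly_roots_finite[OF Q(3)]]) auto
  then have "\<not> inj (\<lambda>k. x ^ r ^ k)"
    using finite_imageD infinite_UNIV_nat by blast
  then obtain i j where ij: "i \<noteq> j" "x ^ r ^ i = x ^ r ^ j"
    by (auto simp: inj_def)
  have "(x ^ r ^ k) ^ q = \<epsilon> ^ r ^ k + 1" for k
  proof -
    have "(x ^ r ^ k) ^ q = (x ^ q) ^ r ^ k"
      by (simp add: mult.commute flip: power_mult)
    also have "\<dots> = (\<epsilon> + 1) ^ r ^ k"
      by (simp add: \<epsilon>_def)
    also have "\<dots> = \<epsilon> ^ r ^ k + 1 ^ r ^ k"
      by (rule freshmans_dream'[OF CHAR]) (simp add: r_def)
    finally show ?thesis
      by simp
  qed
  then have "\<epsilon> ^ r ^ i = \<epsilon> ^ r ^ j"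
    using ij(2) by (metis add_right_cancel)
  then have "av \<epsilon> ^ r ^ i = av \<epsilon> ^ r ^ j"
    by (simp flip: av_power)
  moreover have "av \<epsilon> \<noteq> 1" "av \<epsilon> \<noteq> 0"
    using x by (auto simp: \<epsilon>_def)
  ultimately have "r ^ i = r ^ j"
    using x unfolding \<epsilon>_def
    by (metis less_irrefl linorder_neqE_nat power_strict_decreasing)
  then show False
    using ij(1) prime_gt_1_nat[OF r] by simp
qed

text \<open>Chevalley's extension is applied to the polynomials in \<open>1 / l\<close> over the
  prime field, \<open>d\<close> being a common denominator. Containing that field makes all nonzero
  integers units of \<open>B\<close>.\<close>

lemma exists_place:
  fixes l :: "'a::field"
  assumes l: "prime_ring_transcendental l"
  obtains B where "place B" "l \<notin> B" "\<And>n. of_nat n \<noteq> (0 :: 'a) \<Longrightarrow> inverse (of_nat n) \<in> B"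
proof -
  note Z = is_subring_Ints[where ?'a = 'a]
  define A where "A = {x. \<exists>d P. d \<in> \<int> \<and> d \<noteq> 0 \<and> coeffs_in \<int> P \<and> d * x = poly P (inverse l)}"
  have one: "coeffs_in \<int> (1 :: 'a poly)"
    using coeffs_in_monom[OF Z, of 1 0] by (simp add: monom_0 one_pCons)
  have "coeffs_in \<int> ([:0, 1:] :: 'a poly)"
    using coeffs_in_monom[OF Z, of 1 1] by (simp add: monom_altdef)
  moreover have "l \<noteq> 0"
    using l calculation by (auto simp: prime_ring_transcendental_def)
  ultimately have X: "coeffs_in \<int> ([:0, 1:] :: 'a poly)" and l0: "l \<noteq> 0"
    by simp_all
  have inv: "inverse (of_nat n) \<in> A" if "of_nat n \<noteq> (0 :: 'a)" for n
  proof -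
    have "of_nat n * inverse (of_nat n) = poly 1 (inverse l)"
      using that by simp
    then show ?thesis
      unfolding A_def using that one Ints_of_nat by blast
  qed
  have "1 \<in> A"
    using inv[of 1] by simp
  moreover have "x - y \<in> A \<and> x * y \<in> A" if xy: "x \<in> A" "y \<in> A" for x y
  proof -
    obtain d P e Q where dP: "d \<in> \<int>" "d \<noteq> 0" "coeffs_in \<int> P" "d * x = poly P (inverse l)"
      and eQ: "e \<in> \<int>" "e \<noteq> 0" "coeffs_in \<int> Q" "e * y = poly Q (inverse l)"
      using xy unfolding A_def by blast
    have "d * e * (x - y) = poly (smult e P - smult d Q) (inverse l)"
      by (simp add: algebra_simps flip: dP(4) eQ(4))
    moreover have "d * e * (x * y) = poly (P * Q) (inverse l)"
      by (simp flip: dP(4) eQ(4))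
    moreover have "coeffs_in \<int> (smult e P - smult d Q)" "coeffs_in \<int> (P * Q)"
      using dP eQ by (auto intro!: coeffs_in_diff[OF Z] coeffs_in_mult[OF Z] coeffs_in_smult[OF Z])
    moreover have "d * e \<in> \<int>" "d * e \<noteq> 0"
      using dP eQ by auto
    ultimately show ?thesis
      unfolding A_def by blast
  qed
  ultimately have A: "is_subring A"
    by (simp add: is_subring_def)
  have uA: "inverse l \<in> A"
  proof -
    have "1 * inverse l = poly [:0, 1:] (inverse l)"
      by simp
    then show ?thesis
      unfolding A_def using X Ints_1 one_neq_zero by blast
  qed
  have lA: "l \<notin> A"
  proof
    assume "l \<in> A"
    then obtain d P where dP: "d \<in> \<int>" "d \<noteq> 0" "coeffs_in \<int> P" "d * l = poly P (inverse l)"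
      unfolding A_def by blast
    \<comment> \<open>Clearing the powers of \<open>1 / l\<close> would give an algebraic equation
      for \<open>l\<close> with leading coefficient \<open>d\<close>.\<close>
    define Q where "Q = monom d (Suc (degree P)) - reflect_poly P"
    have "poly Q l = 0"
      using l0 by (simp add: Q_def poly_monom poly_reflect_poly_nz flip: dP(4))
    moreover have "coeffs_in \<int> Q"
      unfolding Q_def using dP
      by (intro coeffs_in_diff[OF Z] coeffs_in_monom[OF Z] coeffs_in_reflect[OF Z])
    ultimately have "Q = 0"
      using l by (auto simp: prime_ring_transcendental_def)
    moreover have "coeff Q (Suc (degree P)) = d"
      by (simp add: Q_def coeff_reflect_poly)
    ultimately show False
      using dP(2) by simp
  qed
  obtain B where "is_subring B" "A \<subseteq> B" "l \<notin> B" "\<And>x. x \<in> B \<or> inverse x \<in> B"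
    using chevalley_extension[OF A lA uA] by blast
  then show ?thesis
    using inv by (intro that[of B]) (auto intro: place.intro)
qed

lemma prime_ring_transcendental_power_neq_1:
  assumes "prime_ring_transcendental l" "0 < k"
  shows "l ^ k \<noteq> 1"
proof
  note Z = is_subring_Ints[where ?'a = 'a]
  assume "l ^ k = 1"
  then have "poly (monom 1 k - monom 1 0) l = 0"
    by (simp add: poly_monom)
  moreover have "coeffs_in \<int> (monom 1 k - monom 1 0 :: 'a poly)"
    by (intro coeffs_in_diff[OF Z] coeffs_in_monom[OF Z] Ints_1)
  ultimately have "monom 1 k - monom 1 0 = (0 :: 'a poly)"
    using assms(1) unfolding prime_ring_transcendental_def by blast
  then have "coeff (monom 1 k - monom 1 0 :: 'a poly) k = 0"
    by simp
  then show False
    using assms(2) by simp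
qed

section \<open>The choice of the parameter\<close>

context ultrametric_field
begin

text \<open>For odd \<open>p\<close> the parameter solves \<open>b (4 b - 1) (2 b - (q + 1)) = 1\<close>, for \<open>p = 2\<close> it solves
  \<open>b\<^sup>2 - b = 1\<close>: all factors are units, both for \<open>av\<close> and at any place of characteristic zero or \<open>p\<close>.\<close>

lemma exists_parameter:
  assumes alg: "alg_closed_field TYPE('a)" and p: "prime p" and residue: "av (of_nat p) < 1"
    and q: "\<not> p dvd q"
  obtains b where "av b \<le> 1" "av (of_nat q * b + of_nat (q choose 2) - (of_nat q)\<^sup>2) = 1"
    "p = 2 \<Longrightarrow> av (of_nat q * b + of_nat (q choose 2)) = 1"
    "\<And>B. place B \<Longrightarrow> (\<And>n. of_nat n \<noteq> (0 :: 'a) \<Longrightarrow> inverse (of_nat n) \<in> B) \<Longrightarrow>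
        b \<in> B \<and> b \<notin> place.M B \<and> 1 - 4 * b \<notin> place.M B"
proof (cases "p = 2")
  case True
  \<comment> \<open>Modulo 2 this is \<open>b^2 + b + 1\<close>, so \<open>b\<close> reduces to a
    primitive cube root of unity, outside the field of two elements.\<close>
  have "0 < degree [:- 1, - 1, 1 :: 'a:]"
    by simp
  then obtain b :: 'a where "poly [:- 1, - 1, 1:] b = 0"
    using alg unfolding alg_closed_field_def by blast
  then have b: "b * (b - 1) = 1"
    by (simp add: algebra_simps)
  have le: "av b \<le> 1"
  proof (rule ccontr)
    assume gt: "\<not> av b \<le> 1"
    then have "av (b - 1) = av b"
      using av_add_eq[of "- 1" b] by simp
    then have "av b ^ 2 = 1"
      using arg_cong[OF b, of av] by (simp add: av_mult power2_eq_square)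
    moreover have "1 < av b ^ 2"
      using gt by (intro one_less_power) auto
    ultimately show False
      by simp
  qed
  then have "av (b - 1) \<le> 1"
    by (rule av_diff_le_1) simp
  moreover have "av (b * (b - 1)) = 1"
    unfolding b by simp
  ultimately have "av b = 1" "av (b - 1) = 1"
    using av_prod_dvd_1[OF _ le] by blast+
  \<comment> \<open>Both unit conditions have the form \<open>q b\<close> plus an integer with
    \<open>q\<close> odd, hence reduce to this one.\<close>
  have odd_even: "av (b + of_int n) = 1" for n
  proof -
    have small: "av (of_int m) < 1" if "even m" for m
    proof -
      obtain k where k: "m = int p * k"
        using \<open>even m\<close> True by (auto elim: dvdE)
      show ?thesis
        using residue by (simp add: k av_mult_less_1)
    qed
    show ?thesis
    proof (cases "even n")
      case True
      then show ?thesis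
        using av_eq_1_cong[of "b + of_int n" b] small[of n] \<open>av b = 1\<close> by simp
    next
      case False
      have eq: "b + of_int n - (b - 1) = of_int (n + 1)"
        by simp
      show ?thesis
        using av_eq_1_cong[of "b + of_int n" "b - 1"] small[of "n + 1"] False \<open>av (b - 1) = 1\<close>
        unfolding eq by simp
    qed
  qed
  have unit: "av (of_nat q * b + of_int n) = 1" for n
  proof -
    have "odd q"
      using q True by simp
    then have "p dvd q - 1"
      using True by simp
    then have "av (of_nat (q - 1) * b) < 1"
      using le by (intro av_mult_less_1 av_of_nat_dvd[OF residue])
    moreover have "of_nat q * b + of_int n - (b + of_int n) = of_nat (q - 1) * b"
      using \<open>odd q\<close> by (cases q) (simp_all add: algebra_simps)
    ultimately show ?thesis
      using av_eq_1_cong odd_even by metis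
  qed
  show ?thesis
  proof (rule that[OF le])
    show "av (of_nat q * b + of_nat (q choose 2) - (of_nat q)\<^sup>2) = 1"
      using unit[of "int (q choose 2) - int q ^ 2"] by (simp add: algebra_simps)
    show "av (of_nat q * b + of_nat (q choose 2)) = 1"
      using unit[of "int (q choose 2)"] by simp
    fix B :: "'a set" assume "place B" and inv: "\<And>n. of_nat n \<noteq> (0 :: 'a) \<Longrightarrow> inverse (of_nat n) \<in> B"
    then interpret place B
      by simp
    have b0: "b \<noteq> 0"
      using b by auto
    have bB: "b \<in> B"
    proof (rule ccontr)
      assume "b \<notin> B"
      then have y: "inverse b \<in> M"
        by (rule inverse_in_M)
      \<comment> \<open>The equation divided by \<open>b^2\<close>: the left side would lie in
        \<open>M\<close>.\<close>
      have "inverse b + inverse b * inverse b = inverse b * inverse b * (b * (b - 1) + b)"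
        using b0 by (simp only: b) (simp add: field_simps)
      also have "\<dots> = 1"
        using b0 by (simp add: field_simps)
      finally show False
        using M_add[OF y M_mult[OF y M_subset[OF y]]] one_not_in_M by simp
    qed
    moreover have "b \<notin> M"
      using M_mult[of b "b - 1"] b one_not_in_M subring_diff[OF B bB subring_1[OF B]] by auto
    \<comment> \<open>The cofactor \<open>4 b - 3\<close> makes the product an integer,
      \<open>-16 (b^2 - b) - 3 = -19\<close>, which is nonzero in the field because 19 is
      odd.\<close>
    moreover have "1 - 4 * b \<notin> M"
    proof
      assume m: "1 - 4 * b \<in> M"
      have "4 * b - 3 \<in> B"
        by (intro subring_diff[OF B] subring_mult[OF B] subring_numeral[OF B] bB)
      then have "(1 - 4 * b) * (4 * b - 3) \<in> M"
        by (rule M_mult[OF m])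
      moreover have "(1 - 4 * b) * (4 * b - 3) = - 16 * (b * (b - 1)) - 3"
        by (simp add: algebra_simps)
      ultimately have "- (- 19) \<in> M"
        unfolding b using M_minus by fastforce
      moreover have "of_nat 19 \<noteq> (0 :: 'a)"
        using av_of_nat_eq_1[OF residue p, of 19] True by (metis av_0 dvd_numeral_simp even_numeral odd_numeral zero_neq_one)
      ultimately show False
        using not_in_M_if_inverse[of 19] inv[of 19] by simp
    qed
    ultimately show "b \<in> B \<and> b \<notin> M \<and> 1 - 4 * b \<notin> M"
      by simp
  qed
next
  case False
  then have odd: "\<not> p dvd 2"
    using p primes_dvd_imp_eq two_is_prime_nat by blast
  have two: "av 2 = 1"
    using av_of_nat_eq_1[OF residue p odd] by simp
  then have two0: "(2 :: 'a) \<noteq> 0"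
    by auto
  have "av (2 * 2) = 1"
    unfolding av_mult two by simp
  then have four: "av 4 = 1"
    by simp
  have "(2 :: 'a) * 2 * 2 \<noteq> 0"
    using two0 by (simp only: mult_eq_0_iff) simp
  then have eight0: "(8 :: 'a) \<noteq> 0"
    by simp
  \<comment> \<open>Twice the quantity in the first unit condition equals
    \<open>q (2 b - c)\<close>; the factors \<open>b\<close> and \<open>4 b - 1\<close> of the
    equation serve the place.\<close>
  define c where "c = (of_nat (q + 1) :: 'a)"
  have c: "av c \<le> 1"
    unfolding c_def by (rule av_of_nat_le_1)
  have "0 < degree [:- 1, c, - (4 * c + 2), 8:]"
    using eight0 by simp
  then obtain b where "poly [:- 1, c, - (4 * c + 2), 8:] b = 0"
    using alg unfolding alg_closed_field_def by blast
  then have b: "b * (4 * b - 1) * (2 * b - c) = 1"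
    by (simp add: algebra_simps)
  have le: "av b \<le> 1"
  proof (rule ccontr)
    assume gt: "\<not> av b \<le> 1"
    have "av (4 * b - 1) = av b" "av (2 * b - c) = av b"
      using av_add_eq[of "- 1" "4 * b"] av_add_eq[of "- c" "2 * b"] gt c
      by (simp_all add: av_mult two four)
    then have "av b ^ 3 = 1"
      using arg_cong[OF b, of av] by (simp add: av_mult power3_eq_cube)
    moreover have "1 < av b ^ 3"
      using gt by (intro one_less_power) auto
    ultimately show False
      by simp
  qed
  have "av (4 * b - 1) \<le> 1" "av (2 * b - c) \<le> 1"
    using le c by (auto intro!: av_diff_le_1 av_mult_le_1)
  then have unit: "av (2 * b - c) = 1"
    using av_mult_eq_1_iff[of "b * (4 * b - 1)" "2 * b - c"] b le by (auto intro: av_mult_le_1)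
  show ?thesis
  proof (rule that[OF le])
    have "2 * (q choose 2) + q = q * q"
      by (cases q) (simp_all add: choose_two)
    then have "(of_nat (2 * (q choose 2) + q) :: 'a) = of_nat (q * q)"
      by simp
    then have "2 * (of_nat q * b + of_nat (q choose 2) - (of_nat q)\<^sup>2) = of_nat q * (2 * b - c)"
      by (simp add: c_def algebra_simps power2_eq_square)
    moreover have "av (of_nat q) = 1"
      by (rule av_of_nat_eq_1[OF residue p q])
    ultimately have "av (2 * (of_nat q * b + of_nat (q choose 2) - (of_nat q)\<^sup>2)) = 1"
      using unit by (simp add: av_mult)
    then show "av (of_nat q * b + of_nat (q choose 2) - (of_nat q)\<^sup>2) = 1"
      unfolding av_mult two by simp
    show "av (of_nat q * b + of_nat (q choose 2)) = 1" if "p = 2"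
      using False that by simp
    fix B :: "'a set" assume "place B" and inv: "\<And>n. of_nat n \<noteq> (0 :: 'a) \<Longrightarrow> inverse (of_nat n) \<in> B"
    then interpret place B
      by simp
    have b0: "b \<noteq> 0"
      using b by auto
    have twoM: "2 \<notin> M"
      using inv[of 2] two0 by (intro not_in_M_if_inverse) simp_all
    then have "2 * 2 \<notin> M"
      by (intro M_mult_not_in subring_numeral[OF B])
    then have fourM: "4 \<notin> M"
      by simp
    have cB: "c \<in> B"
      unfolding c_def by (rule subring_of_nat[OF B])
    have bB: "b \<in> B"
    proof (rule ccontr)
      assume "b \<notin> B"
      then have y: "inverse b \<in> M"
        by (rule inverse_in_M)
      \<comment> \<open>The equation divided by \<open>b^3\<close> is
        \<open>(4 - 1 / b) (2 - c / b) = 1 / b^3\<close>. With \<open>1 / b\<close> in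
        \<open>M\<close> the left side would be a unit and the right side not.\<close>
      have "4 + - inverse b \<notin> M" "2 + - (inverse b * c) \<notin> M"
        by (intro add_M_not_in fourM twoM M_minus M_mult y cB)+
      then have "(4 + - inverse b) * (2 + - (inverse b * c)) \<notin> M"
        by (intro M_mult_not_in subring_add[OF B] subring_minus[OF B] subring_mult[OF B]
            subring_numeral[OF B] M_subset[OF y] cB)
      moreover have "(4 + - inverse b) * (2 + - (inverse b * c))
          = inverse b * inverse b * inverse b * (b * (4 * b - 1) * (2 * b - c))"
        using b0 by (simp add: field_simps)
      ultimately have "inverse b * inverse b * inverse b \<notin> M"
        by (simp add: b)
      then show False
        using M_mult y M_subset by blast
    qed
    have prod: "b * ((4 * b - 1) * (2 * b - c)) = 1" "(1 - 4 * b) * (- b * (2 * b - c)) = 1"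
      using b by (simp_all add: algebra_simps)
    have "(4 * b - 1) * (2 * b - c) \<in> B" "- b * (2 * b - c) \<in> B"
      by (intro subring_mult[OF B] subring_diff[OF B] subring_minus[OF B] subring_numeral[OF B]
          subring_1[OF B] bB cB)+
    then have "b \<notin> M" "1 - 4 * b \<notin> M"
      using M_mult[of b "(4 * b - 1) * (2 * b - c)"] M_mult[of "1 - 4 * b" "- b * (2 * b - c)"]
        one_not_in_M unfolding prod by auto
    with bB show "b \<in> B \<and> b \<notin> M \<and> 1 - 4 * b \<notin> M"
      by simp
  qed
qed

text \<open>Frobenius is injective on the residue field: \<open>(x - 1)^p\<close> and
  \<open>x^p - 1\<close> differ by multiples of \<open>p\<close>. This keeps \<open>p\<close> out of
  the order \<open>q\<close>.\<close>

lemma av_power_prime_diff_1: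
  assumes p: "prime p" and residue: "av (of_nat p) < 1" and x: "av x \<le> 1"
    and less: "av (x ^ p - 1) < 1"
  shows "av (x - 1) < 1"
proof -
  define y where "y = x - 1"
  have y: "av y \<le> 1"
    unfolding y_def using x by (intro av_diff_le_1) auto
  have p0: "0 < p"
    using p by (rule prime_gt_0_nat)
  have "x ^ p = (y + 1) ^ p"
    by (simp add: y_def)
  also have "\<dots> = (\<Sum>k\<le>p. of_nat (p choose k) * y ^ k)"
    by (simp add: binomial_ring)
  also have "{..p} = insert 0 (insert p {0<..<p})"
    by auto
  also have "(\<Sum>k\<in>\<dots>. of_nat (p choose k) * y ^ k)
      = 1 + (y ^ p + (\<Sum>k\<in>{0<..<p}. of_nat (p choose k) * y ^ k))"
    using p0 by simp
  finally have "y ^ p = (x ^ p - 1) - (\<Sum>k\<in>{0<..<p}. of_nat (p choose k) * y ^ k)"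
    by simp
  moreover have "av (\<Sum>k\<in>{0<..<p}. of_nat (p choose k) * y ^ k) < 1"
  proof (rule av_sum_less)
    fix k assume "k \<in> {0<..<p}"
    then show "av (of_nat (p choose k) * y ^ k) < 1"
      using dvd_choose_prime[of k p] p y
      by (intro av_mult_less_1 av_of_nat_dvd[OF residue] av_power_le_1) auto
  qed simp
  ultimately have "av y ^ p < 1"
    using less av_diff_less_1 by (metis av_power)
  then show ?thesis
    unfolding y_def[symmetric] by (meson av_nonneg not_le one_le_power)
qed

lemma
  assumes lam: "av lam = 1" and pos: "0 < red_order av lam"
  shows av_power_red_order: "av (lam ^ red_order av lam - 1) < 1"
    and av_power_not_dvd: "\<not> red_order av lam dvd d \<Longrightarrow> av (lam ^ d - 1) = 1"
    and red_order_dvd: "prime p \<Longrightarrow> av (of_nat p) < 1 \<Longrightarrow> \<not> p dvd red_order av lam"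
proof -
  let ?P = "\<lambda>q. 0 < q \<and> av (lam ^ q - 1) < 1"
  define q where "q = red_order av lam"
  have ex: "\<exists>q. ?P q" and q: "q = (LEAST q. ?P q)"
    using pos by (auto simp: red_order_def q_def split: if_splits)
  have "?P q"
    unfolding q using ex by (rule LeastI_ex)
  then show *: "av (lam ^ red_order av lam - 1) < 1"
    by (simp add: q_def)
  have minimal: "\<not> av (lam ^ d - 1) < 1" if "0 < d" "d < q" for d
    using not_less_Least[of d ?P] that unfolding q by auto
  have av_le: "av (lam ^ d - 1) \<le> 1" for d
    using lam by (intro av_diff_le_1 av_power_le_1) auto
  show "av (lam ^ d - 1) = 1" if d: "\<not> red_order av lam dvd d"
  proof -
    have mult: "av (lam ^ (q * k) - 1) < 1" for k
    proof (induction k)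
      case (Suc k)
      have "lam ^ (q * Suc k) - 1 = lam ^ q * (lam ^ (q * k) - 1) + (lam ^ q - 1)"
        by (simp add: power_add algebra_simps)
      moreover have "av (lam ^ q * (lam ^ (q * k) - 1)) < 1"
        using lam Suc by (intro av_mult_less_1') (simp_all add: av_power)
      ultimately show ?case
        using av_add_less_1 \<open>?P q\<close> by metis
    qed simp
    define m where "m = d mod q"
    have "m < q" "0 < m"
      using d \<open>?P q\<close> by (auto simp: m_def q_def mod_greater_zero_iff_not_dvd)
    have "lam ^ d = lam ^ (q * (d div q)) * lam ^ m"
      unfolding m_def by (simp flip: power_add)
    then have "(lam ^ m - 1) - (lam ^ d - 1) = - (lam ^ m * (lam ^ (q * (d div q)) - 1))"
      by (simp add: algebra_simps)
    moreover have "av (- (lam ^ m * (lam ^ (q * (d div q)) - 1))) < 1"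
      using lam mult unfolding av_minus by (intro av_mult_less_1') (simp_all add: av_power)
    ultimately have "av (lam ^ m - 1) < 1 \<longleftrightarrow> av (lam ^ d - 1) < 1"
      using av_less_1_cong by metis
    then show ?thesis
      using minimal[OF \<open>0 < m\<close> \<open>m < q\<close>] av_le[of d] by simp
  qed
  show "\<not> p dvd red_order av lam" if p: "prime p" "av (of_nat p) < 1"
  proof
    assume "p dvd red_order av lam"
    then obtain m where "red_order av lam = p * m" ..
    then have m: "q = m * p"
      by (simp add: q_def mult.commute)
    then have "0 < m" "m < q"
      using \<open>?P q\<close> prime_gt_1_nat[OF p(1)] by auto
    moreover have "av (lam ^ m - 1) < 1"
    proof (rule av_power_prime_diff_1[OF p])
      show "av (lam ^ m) \<le> 1"
        using lam by (simp add: av_power)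
      show "av ((lam ^ m) ^ p - 1) < 1"
        using \<open>?P q\<close> by (simp add: m power_mult)
    qed
    ultimately show False
      using minimal by blast
  qed
qed

end

section \<open>Combination of the place, the parameter and the ramification\<close>

theorem theoremA:
  fixes av :: "'a::field \<Rightarrow> real" and p :: nat and lam :: 'a
  assumes "prime p"
    and "ultrametric_abs av"
    and "alg_closed_field TYPE('a)"
    and "residue_char av p"
    and "av lam = 1"
    and "red_order av lam > 0"
    and "lam ^ red_order av lam \<noteq> 1"
    and "CHAR('a) = 0 \<Longrightarrow> transcendental_prime lam"
  shows "\<exists>P :: 'a poly.
           poly P 0 = 0 \<and> coeff P 1 = lam \<and> (\<forall>i. av (coeff P i) \<le> 1) \<and>
           degree P \<le> 2 * red_order av lam + 1 \<and>
           (\<forall>n::nat. 1 \<le> n \<longrightarrow> optimal_cycle av (poly P) lam (red_order av lam) p n)"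
proof -
  interpret ultrametric_field av
    by unfold_locales (rule assms(2))
  define q where "q = red_order av lam"
  have p: "prime p" and alg: "alg_closed_field TYPE('a)" and residue: "av (of_nat p) < 1"
    and av_lam: "av lam = 1" and q: "0 < q" and lam_q: "lam ^ q \<noteq> 1"
    using assms by (simp_all add: residue_char_def q_def)
  have small: "av (lam ^ q - 1) < 1" and order: "\<And>d. \<not> q dvd d \<Longrightarrow> av (lam ^ d - 1) = 1"
    and p_q: "\<not> p dvd q"
    using av_power_red_order av_power_not_dvd red_order_dvd p residue av_lam q unfolding q_def by blast+
  \<comment> \<open>In positive characteristic this is automatic, because \<open>lam ^ q - 1\<close>
    is small but nonzero.\<close>
  have trans: "prime_ring_transcendental lam"
  proof (cases "CHAR('a) = 0")
    case True
    then show ?thesis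
      using assms(8) transcendental_prime_imp by blast
  next
    case False
    then have "prime CHAR('a)"
      by (simp add: prime_CHAR_semidom)
    then show ?thesis
      using small lam_q by (intro prime_ring_transcendental_if_CHAR[of _ q]) simp_all
  qed
  obtain B where B: "place B" "lam \<notin> B"
    and inv: "\<And>n. of_nat n \<noteq> (0 :: 'a) \<Longrightarrow> inverse (of_nat n) \<in> B"
    using exists_place[OF trans] by blast
  obtain b where b: "av b \<le> 1"
    and unit: "av (of_nat q * b + of_nat (q choose 2) - (of_nat q)\<^sup>2) = 1"
      "p = 2 \<Longrightarrow> av (of_nat q * b + of_nat (q choose 2)) = 1"
    and b_place: "b \<in> B \<and> b \<notin> place.M B \<and> 1 - 4 * b \<notin> place.M B"
    using exists_parameter[OF alg p residue p_q] B(1) inv by metis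
  have "of_nat q \<noteq> (0 :: 'a)"
    using av_of_nat_eq_1[OF residue p p_q] by auto
  then have "of_nat q \<notin> place.M B"
    using place.not_in_M_if_inverse[OF B(1)] inv by blast
  then interpret place_cycle_poly B lam b q
    using B q b_place by (simp add: place_cycle_poly_def place_cycle_poly_axioms_def)
  define P where "P = cycle_poly lam b q"
  have P: "integral_poly P" "coeff P 0 = 0" "coeff P 1 = lam" "degree P \<le> 2 * q + 1"
    unfolding P_def using integral_cycle_poly[of lam b q] av_lam b cycle_poly_coeff_0[OF q]
      cycle_poly_coeff_1[OF q] degree_cycle_poly_le[OF q] by auto
  have "optimal_cycle av (poly P) lam q p n" if n: "1 \<le> n" for n
  proof -
    obtain m where m: "n = Suc m"
      using n by (cases n) auto
    have exact: "exact_order (q * (\<Sum>i\<le>k. p ^ i) + 1) (iter_poly P (q * p ^ k) - [:0, 1:])" for k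
      unfolding P_def by (rule exact_order_cycle_poly[OF p residue q p_q av_lam small b unit])
    show ?thesis
    proof (rule optimal_cycle_if_exact_order[OF alg p q n P(1-3) av_lam order])
      \<comment> \<open>The orders at levels \<open>n\<close> and \<open>n - 1\<close> differ by the
        last summand \<open>q p^n\<close>, the number of points on the cycle.\<close>
      show "exact_order (q * p ^ n + (q * (\<Sum>i\<le>m. p ^ i) + 1)) (iter_poly P (q * p ^ n) - [:0, 1:])"
        using exact[of n] by (simp add: m algebra_simps)
      show "exact_order (q * (\<Sum>i\<le>m. p ^ i) + 1) (iter_poly P (q * p ^ (n - 1)) - [:0, 1:])"
        using exact[of m] by (simp add: m)
      show "lam ^ k \<noteq> 1" if "0 < k" for k
        using prime_ring_transcendental_power_neq_1[OF trans that] .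
      show "poly (pderiv (iter_poly P L)) z ^ p \<noteq> 1" if "0 < L" "poly (iter_poly P L) z = z" for z L
        using multiplier_not_root_of_unity[of L p z] that prime_gt_0_nat[OF p] by (simp add: P_def)
    qed
  qed
  then show ?thesis
    using P by (intro exI[of _ P]) (simp add: integral_poly_def poly_0_coeff_0 q_def)
qed

end
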